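(* Let $\Gamma$ be a biregular graph in $\mathcal{G}(\theta_0,1,-t)$ (for some $\theta_0$ and $t$ with $\theta_0>1>-t$). Then $t=2$, and $\Gamma$ is the Petersen cone or the Van Dam-Fano graph.
   Context: All graphs are finite and simple; eigenvalues of a graph are those of its adjacency matrix. For $\theta_0 > \theta_1 > \theta_2$, $\mathcal{G}(\theta_0,\theta_1,\theta_2)$ denotes the set of connected nonregular graphs having precisely three distinct eigenvalues $\theta_0$, $\theta_1$, $\theta_2$. A graph is biregular if it has precisely two distinct valencies (degrees). The Petersen cone is the 11-vertex graph obtained from the Petersen graph by adjoining a vertex adjacent to all its vertices. The Van Dam-Fano graph is the 14-vertex graph formed by taking the (bipartite) point-block incidence graph of the complement of the Fano plane (points: the 7 points of the Fano plane; blocks: the complements of the 7 lines) and adding an edge between every pair of distinct blocks. *)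

theory Defs
  imports "Jordan_Normal_Form.Spectral_Radius" "Graph_Theory.Graph_Theory"
begin

text \<open>
  A finite simple graph is a \<open>pair_graph\<close>: a finite vertex set with a symmetric irreflexive set
  of ordered pairs, each edge being represented by its two orientations. In particular the valency
  of a vertex is its \<open>out_degree\<close>.
\<close>

text \<open>
  Matrices are indexed by numbers below the dimension, so an enumeration of the vertices has to be
  chosen; another choice conjugates the adjacency matrix by a permutation matrix and hence does
  not affect the eigenvalues.
\<close>

definition vertex_list :: "'a pair_pre_digraph \<Rightarrow> 'a list" where
  "vertex_list G = (SOME vs. distinct vs \<and> set vs = pverts G)"

definition adjacency_matrix :: "'a pair_pre_digraph \<Rightarrow> real mat" where
  "adjacency_matrix G =
     (let vs = vertex_list G; n = length vs
      in mat n n (\<lambda>(i, j). if (vs ! i, vs ! j) \<in> parcs G then 1 else 0))"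

text \<open>
  The adjacency matrix is real symmetric, so its real eigenvalues are all its eigenvalues.
\<close>

definition graph_eigenvalues :: "'a pair_pre_digraph \<Rightarrow> real set" where
  "graph_eigenvalues G = spectrum (adjacency_matrix G)"

definition valencies :: "'a pair_pre_digraph \<Rightarrow> nat set" where
  "valencies G = out_degree (with_proj G) ` pverts G"

definition regular_graph :: "'a pair_pre_digraph \<Rightarrow> bool" where
  "regular_graph G \<longleftrightarrow> (\<exists>k. \<forall>v \<in> pverts G. out_degree (with_proj G) v = k)"

definition biregular_graph :: "'a pair_pre_digraph \<Rightarrow> bool" where
  "biregular_graph G \<longleftrightarrow> card (valencies G) = 2"

text \<open>Only meant to be used with \<open>\<theta>\<^sub>0 > \<theta>\<^sub>1 > \<theta>\<^sub>2\<close>.\<close>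

definition three_eigenvalue_graphs ::
    "real \<Rightarrow> real \<Rightarrow> real \<Rightarrow> 'a pair_pre_digraph set" where
  "three_eigenvalue_graphs \<theta>\<^sub>0 \<theta>\<^sub>1 \<theta>\<^sub>2 =
     {G. pair_graph G \<and> Digraph_Component.connected (with_proj G) \<and> \<not> regular_graph G \<and>
         graph_eigenvalues G = {\<theta>\<^sub>0, \<theta>\<^sub>1, \<theta>\<^sub>2}}"

text \<open>The Petersen graph as the Kneser graph on the 2-subsets of a 5-set.\<close>

definition petersen_graph :: "nat set pair_pre_digraph" where
  "petersen_graph =
     (let V = {A. A \<subseteq> {..<5} \<and> card A = 2}
      in \<lparr> pverts = V, parcs = {(A, B). A \<in> V \<and> B \<in> V \<and> A \<inter> B = {}} \<rparr>)"

definition cone :: "'a pair_pre_digraph \<Rightarrow> 'a option pair_pre_digraph" where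
  "cone G =
     \<lparr> pverts = insert None (Some ` pverts G),
       parcs = {(Some u, Some v) | u v. (u, v) \<in> parcs G}
         \<union> {(None, Some v) | v. v \<in> pverts G}
         \<union> {(Some v, None) | v. v \<in> pverts G} \<rparr>"

definition petersen_cone :: "nat set option pair_pre_digraph" where
  "petersen_cone = cone petersen_graph"

text \<open>
  The Fano plane on the points \<open>0, \<dots>, 6\<close>, its lines being the translates modulo 7 of the perfect
  difference set \<open>{0, 1, 3}\<close>.
\<close>

definition fano_points :: "nat set" where
  "fano_points = {..<7}"

definition fano_lines :: "nat set set" where
  "fano_lines = (\<lambda>i. {i, (i + 1) mod 7, (i + 3) mod 7}) ` {..<7}"

definition fano_complement_blocks :: "nat set set" where
  "fano_complement_blocks = (\<lambda>L. fano_points - L) ` fano_lines"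

definition van_dam_fano_graph :: "(nat + nat set) pair_pre_digraph" where
  "van_dam_fano_graph =
     \<lparr> pverts = Inl ` fano_points \<union> Inr ` fano_complement_blocks,
       parcs = {(Inl p, Inr B) | p B. p \<in> fano_points \<and> B \<in> fano_complement_blocks \<and> p \<in> B}
         \<union> {(Inr B, Inl p) | p B. p \<in> fano_points \<and> B \<in> fano_complement_blocks \<and> p \<in> B}
         \<union> {(Inr B, Inr C) | B C. B \<in> fano_complement_blocks \<and> C \<in> fano_complement_blocks
                \<and> B \<noteq> C} \<rparr>"

end

theory Submission
  imports Defs "HOL-Analysis.Function_Topology"
begin

text \<open>
  Since the largest eigenvalue is simple, \<open>(A - I)(A + tI) = \<alpha>\<alpha>\<^sup>T\<close> for a positive eigenvector \<open>\<alpha>\<close>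
  of \<open>\<theta>\<^sub>0\<close>; hence a vertex \<open>x\<close> has valency \<open>t + \<alpha>\<^sub>x\<^sup>2\<close>, and \<open>x \<noteq> y\<close> have \<open>\<alpha>\<^sub>x\<alpha>\<^sub>y\<close> common neighbours,
  minus \<open>t - 1\<close> if they are adjacent. In the biregular case \<open>\<alpha>\<close> takes two values \<open>a > b\<close>, on
  classes \<open>V1\<close> and \<open>V2\<close>, and this partition is equitable. The second eigenvalue of its quotient
  matrix is \<open>1\<close> or \<open>-t\<close>; in the first case \<open>ab = t - 1\<close>, so adjacent vertices of \<open>V2\<close> would have
  \<open>b\<^sup>2 - ab < 0\<close> common neighbours, and the coclique \<open>V2\<close> contradicts the trace of the quotient. So
  \<open>ab = 2t\<close>, and \<open>t\<close> and \<open>b\<^sup>2 \<ge> 2\<close> are integers.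

  If all of \<open>V1\<close> is joined to all of \<open>V2\<close>, then \<open>b\<^sup>2 = t = 2\<close>, \<open>V1\<close> is a single vertex and \<open>V2\<close>
  induces a cubic graph on ten vertices in which two vertices have no common neighbour if they are
  adjacent and one otherwise, which is the Petersen graph.

  Otherwise a nonadjacent pair in \<open>V1 \<times> V2\<close> shows that \<open>b\<^sup>2 \<ge> t\<close> and that a vertex of \<open>V2\<close> has at
  least \<open>b\<^sup>2\<close> neighbours in \<open>V1\<close>. Then the neighbourhoods in \<open>V1\<close> of two adjacent vertices of \<open>V2\<close>
  would overlap too much, so \<open>V2\<close> is a coclique, and all parameters are functions of \<open>t\<close> and of the
  number \<open>r\<close> of neighbours in \<open>V2\<close> of a vertex of \<open>V1\<close>. That no eigenvalue other than \<open>\<theta>\<^sub>0\<close>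
  exceeds \<open>1\<close> gives \<open>r\<^sup>2 \<le> 3r + 2t\<close>, whence \<open>t = 2\<close> and \<open>r = 4\<close>; then non-adjacency between
  \<open>V1\<close> and \<open>V2\<close> is the incidence relation of a projective plane of order 2.
\<close>

section \<open>Spectral theory of functions on the vertices\<close>

locale fin_graph =
  fixes V :: "'a set" and E :: "'a \<Rightarrow> 'a \<Rightarrow> bool"
  assumes fin: "finite V"
    and sym: "E x y \<Longrightarrow> E y x"
    and irrefl: "\<not> E x x"
begin

definition nb :: "'a \<Rightarrow> 'a set" where
  "nb x = {y \<in> V. E x y}"

definition ip :: "('a \<Rightarrow> real) \<Rightarrow> ('a \<Rightarrow> real) \<Rightarrow> real" where
  "ip f g = (\<Sum>x\<in>V. f x * g x)"

definition adj_op :: "('a \<Rightarrow> real) \<Rightarrow> 'a \<Rightarrow> real" where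
  "adj_op f x = (\<Sum>y\<in>nb x. f y)"

definition eigenfun :: "real \<Rightarrow> ('a \<Rightarrow> real) \<Rightarrow> bool" where
  "eigenfun l f \<longleftrightarrow> (\<exists>x\<in>V. f x \<noteq> 0) \<and> (\<forall>x\<in>V. adj_op f x = l * f x)"

text \<open>The spectral arguments run on three such subspaces: the whole space, the complement of
  the Perron vector, and the complement of all eigenfunctions. Being cut out by continuous
  functionals, they are closed, which \<open>max_eigenfun\<close> exploits.\<close>

definition orth :: "('a \<Rightarrow> real) set \<Rightarrow> ('a \<Rightarrow> real) set" where
  "orth C = {f. \<forall>v\<in>C. ip v f = 0}"

lemma finite_nb [simp]: "finite (nb x)"
  using fin by (simp add: nb_def)

lemma nb_subset: "nb x \<subseteq> V"
  by (auto simp: nb_def)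

lemma in_nb: "y \<in> nb x \<longleftrightarrow> y \<in> V \<and> E x y"
  by (auto simp: nb_def)

lemma nb_irrefl: "x \<notin> nb x"
  using irrefl by (simp add: nb_def)

lemma adj_op_if: "adj_op f x = (\<Sum>y\<in>V. if E x y then f y else 0)"
  unfolding adj_op_def nb_def using fin by (simp add: sum.inter_filter)

lemma ip_commute: "ip f g = ip g f"
  by (simp add: ip_def mult.commute)

lemma ip_add_right: "ip f (\<lambda>x. g x + h x) = ip f g + ip f h"
  by (simp add: ip_def distrib_left sum.distrib)

lemma ip_diff_right: "ip f (\<lambda>x. g x - h x) = ip f g - ip f h"
  by (simp add: ip_def right_diff_distrib sum_subtractf)

lemma ip_scale_right: "ip f (\<lambda>x. c * g x) = c * ip f g"
  by (simp add: ip_def sum_distrib_left mult.left_commute)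

lemma ip_add_left: "ip (\<lambda>x. g x + h x) f = ip g f + ip h f"
  by (simp add: ip_def distrib_right sum.distrib)

lemma ip_diff_left: "ip (\<lambda>x. g x - h x) f = ip g f - ip h f"
  by (simp add: ip_def left_diff_distrib sum_subtractf)

lemma ip_scale_left: "ip (\<lambda>x. c * g x) f = c * ip g f"
  by (simp add: ip_def sum_distrib_left mult.assoc)

lemmas ip_simps = ip_add_right ip_diff_right ip_scale_right ip_add_left ip_diff_left ip_scale_left

lemma adj_op_add: "adj_op (\<lambda>x. g x + h x) = (\<lambda>x. adj_op g x + adj_op h x)"
  by (simp add: adj_op_def fun_eq_iff sum.distrib)

lemma adj_op_diff: "adj_op (\<lambda>x. g x - h x) = (\<lambda>x. adj_op g x - adj_op h x)"
  by (simp add: adj_op_def fun_eq_iff sum_subtractf)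

lemma adj_op_scale: "adj_op (\<lambda>x. c * g x) = (\<lambda>x. c * adj_op g x)"
  by (simp add: adj_op_def fun_eq_iff sum_distrib_left)

lemmas adj_op_simps = adj_op_add adj_op_diff adj_op_scale

lemma ip_cong: "(\<And>x. x \<in> V \<Longrightarrow> f x = f' x) \<Longrightarrow> (\<And>x. x \<in> V \<Longrightarrow> g x = g' x) \<Longrightarrow> ip f g = ip f' g'"
  by (simp add: ip_def)

lemma adj_op_cong: "(\<And>x. x \<in> V \<Longrightarrow> f x = f' x) \<Longrightarrow> adj_op f = adj_op f'"
  using nb_subset by (auto simp: adj_op_def fun_eq_iff intro!: sum.cong)

lemma ip_self_nonneg: "0 \<le> ip f f"
  by (simp add: ip_def sum_nonneg)

lemma ip_self_eq_0: "ip f f = 0 \<longleftrightarrow> (\<forall>x\<in>V. f x = 0)"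
  unfolding ip_def using fin by (subst sum_nonneg_eq_0_iff) auto

lemma adj_op_sym: "ip f (adj_op g) = ip (adj_op f) g"
proof -
  have "ip f (adj_op g) = (\<Sum>x\<in>V. \<Sum>y\<in>V. if E x y then f x * g y else 0)"
    by (simp add: ip_def adj_op_if sum_distrib_left if_distrib cong: if_cong)
  also have "\<dots> = (\<Sum>y\<in>V. \<Sum>x\<in>V. if E x y then f x * g y else 0)"
    by (rule sum.swap)
  also have "\<dots> = (\<Sum>y\<in>V. \<Sum>x\<in>V. if E y x then f x * g y else 0)"
    using sym by (intro sum.cong refl) metis
  also have "\<dots> = ip (adj_op f) g"
    by (simp add: ip_def adj_op_if sum_distrib_right if_distrib[of "\<lambda>u. u * _"] cong: if_cong)
  finally show ?thesis .
qed

text \<open>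
  The first order condition at a zero of a quadratic form that is nonnegative on an invariant subspace.
\<close>

lemma null_vector_is_eigen:
  assumes nonneg: "\<And>h. h \<in> orth C \<Longrightarrow> ip h (adj_op h) \<le> m * ip h h"
    and inv: "\<And>h. h \<in> orth C \<Longrightarrow> adj_op h \<in> orth C"
    and f: "f \<in> orth C" "ip f (adj_op f) = m * ip f f"
  shows "\<forall>x\<in>V. adj_op f x = m * f x"
proof -
  \<comment> \<open>Up to a factor 2 this is the gradient at \<open>f\<close> of the form
    \<open>m * ip h h - ip h (adj_op h)\<close>; moving along it changes the form to first order by
    \<open>2 * e * ip g g\<close>.\<close>
  define g where "g = (\<lambda>x. m * f x - adj_op f x)"
  define q where "q = m * ip g g - ip g (adj_op g)"
  have gC: "g \<in> orth C"
    using f(1) inv[OF f(1)] by (auto simp: orth_def g_def ip_simps)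
  have q: "q \<ge> 0"
    using nonneg[OF gC] by (simp add: q_def)
  have Qexp: "0 \<le> 2 * e * ip g g + e\<^sup>2 * q" for e
  proof -
    have mem: "(\<lambda>x. f x + e * g x) \<in> orth C"
      using gC f(1) by (auto simp: orth_def ip_simps)
    have fg: "ip f (adj_op g) = ip g (adj_op f)"
      by (metis adj_op_sym ip_commute)
    have gg: "ip g g = m * ip f g - ip g (adj_op f)"
      by (subst (2) g_def) (simp add: ip_simps ip_commute)
    have "0 \<le> m * ip (\<lambda>x. f x + e * g x) (\<lambda>x. f x + e * g x)
        - ip (\<lambda>x. f x + e * g x) (adj_op (\<lambda>x. f x + e * g x))"
      using nonneg[OF mem] by simp
    also have "\<dots> = (m * ip f f - ip f (adj_op f)) + 2 * e * (m * ip f g - ip g (adj_op f)) + e\<^sup>2 * q"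
      by (simp add: ip_simps adj_op_simps q_def fg ip_commute[of g f] algebra_simps power2_eq_square)
    finally show ?thesis
      using f(2) gg by simp
  qed
  have "ip g g = 0"
  proof (rule ccontr)
    assume "ip g g \<noteq> 0"
    then have pos: "ip g g > 0"
      using ip_self_nonneg[of g] by simp
    \<comment> \<open>The denominator \<open>1 + q\<close> covers \<open>q = 0\<close> as well and
      still makes the expansion in \<open>Qexp\<close> negative.\<close>
    define e where "e = - ip g g / (1 + q)"
    have e: "e * (1 + q) = - ip g g"
      using q by (simp add: e_def)
    have "0 \<le> (2 * e * ip g g + e\<^sup>2 * q) * (1 + q)\<^sup>2"
      using Qexp[of e] by (intro mult_nonneg_nonneg) auto
    also have "\<dots> = 2 * ip g g * (e * (1 + q)) * (1 + q) + (e * (1 + q))\<^sup>2 * q"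
      by (simp add: algebra_simps power2_eq_square)
    also have "\<dots> = - ((ip g g)\<^sup>2 * (2 + q))"
      unfolding e by (simp add: algebra_simps power2_eq_square)
    finally show False
      using pos q by (smt (verit) mult_pos_pos zero_less_power)
  qed
  then show ?thesis
    unfolding ip_self_eq_0 by (simp add: g_def)
qed

text \<open>The Rayleigh quotient attains its maximum on the unit sphere of \<open>orth C\<close>,
  which is compact, and \<open>null_vector_is_eigen\<close> turns a maximiser into an eigenfunction.
  This takes the place of diagonalisation.\<close>

lemma max_eigenfun:
  assumes inv: "\<And>h. h \<in> orth C \<Longrightarrow> adj_op h \<in> orth C"
    and f0: "f0 \<in> orth C" "ip f0 f0 \<noteq> 0"
  obtains m v where "v \<in> orth C" "eigenfun m v" "\<And>h. h \<in> orth C \<Longrightarrow> ip h (adj_op h) \<le> m * ip h h"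
proof -
  \<comment> \<open>Functions live on the whole type, so they are pinned to 0 off \<open>V\<close>.
    Then \<open>B\<close> is a product of compact sets, hence compact by Tychonoff, and it contains
    the normalised functions because a unit vector has coordinates in
    \<open>{-1..1}\<close>.\<close>
  define B where "B = PiE UNIV (\<lambda>x. if x \<in> V then {-1..1::real} else {0})"
  define S where "S = B \<inter> {f. ip f f = 1} \<inter> (\<Inter>v\<in>C. {f. ip v f = 0})"
  have coord: "continuous_on UNIV (\<lambda>f::'a \<Rightarrow> real. f x)" for x
    by (rule continuous_on_product_coordinates)
  have "compactin (product_topology (\<lambda>i. euclidean) UNIV) B"
    unfolding B_def by (subst compactin_PiE) auto
  then have cB: "compact B"
    by (simp add: euclidean_product_topology)
  have cl1: "closed {f. ip f f = 1}"
    unfolding ip_def by (intro closed_Collect_eq continuous_intros coord)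
  have cl2: "closed {f. ip v f = 0}" for v
    unfolding ip_def by (intro closed_Collect_eq continuous_intros coord)
  have cS: "compact S"
    unfolding S_def by (intro compact_Int_closed cB cl1 closed_INT ballI cl2)
  have norml: "\<exists>g\<in>S. \<exists>c>0. \<forall>x\<in>V. f x = c * g x" if f: "f \<in> orth C" "ip f f \<noteq> 0" for f
  proof -
    define c where "c = sqrt (ip f f)"
    have c: "c > 0" "c\<^sup>2 = ip f f"
      using f(2) ip_self_nonneg[of f] by (auto simp: c_def)
    define g where "g = (\<lambda>x. if x \<in> V then f x / c else 0)"
    have g: "ip h g = ip h f / c" for h
      by (simp add: ip_def g_def sum_divide_distrib)
    have g1: "ip g g = 1"
      using c f(2) by (simp add: g ip_commute[of g f] power2_eq_square[symmetric])
    have "g x \<in> {-1..1}" if "x \<in> V" for x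
    proof -
      have "(g x)\<^sup>2 \<le> ip g g"
        unfolding ip_def using that fin by (simp add: power2_eq_square member_le_sum[of x V "\<lambda>x. g x * g x"])
      then show ?thesis
        using g1 abs_square_le_1[of "g x"] by (simp add: abs_le_iff)
    qed
    then have "g \<in> B"
      by (auto simp: B_def PiE_def Pi_iff) (simp_all add: g_def)
    moreover have "ip v g = 0" if "v \<in> C" for v
      using that f(1) by (simp add: g orth_def)
    ultimately have "g \<in> S"
      using g1 by (auto simp: S_def)
    moreover have "\<forall>x\<in>V. f x = c * g x"
      using c by (simp add: g_def)
    ultimately show ?thesis
      using c(1) by blast
  qed
  have "S \<noteq> {}"
    using norml[OF f0] by auto
  moreover have "continuous_on S (\<lambda>f. ip f (adj_op f))"
    unfolding ip_def adj_op_def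
    by (intro continuous_intros continuous_on_subset[OF coord]) auto
  ultimately obtain v where v: "v \<in> S" and vmax: "\<And>g. g \<in> S \<Longrightarrow> ip g (adj_op g) \<le> ip v (adj_op v)"
    using continuous_attains_sup[OF cS] by blast
  define m where "m = ip v (adj_op v)"
  have vC: "v \<in> orth C" and v1: "ip v v = 1"
    using v by (auto simp: S_def orth_def)
  have bound: "ip h (adj_op h) \<le> m * ip h h" if h: "h \<in> orth C" for h
  proof (cases "ip h h = 0")
    case True
    then have "ip h (adj_op h) = 0"
      by (simp add: ip_self_eq_0) (simp add: ip_def)
    then show ?thesis
      using True by simp
  next
    case False
    then obtain g c where g: "g \<in> S" "c > 0" "\<forall>x\<in>V. h x = c * g x"
      using norml[OF h] by blast
    have "ip h h = ip (\<lambda>x. c * g x) (\<lambda>x. c * g x)"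
      using g by (intro ip_cong) auto
    then have hh: "ip h h = c\<^sup>2"
      using g(1) by (simp add: S_def ip_simps power2_eq_square)
    have "adj_op h = adj_op (\<lambda>x. c * g x)"
      using g by (intro adj_op_cong) auto
    then have "ip h (adj_op h) = ip (\<lambda>x. c * g x) (\<lambda>x. c * adj_op g x)"
      using g by (intro ip_cong) (auto simp: adj_op_simps)
    then have "ip h (adj_op h) = c\<^sup>2 * ip g (adj_op g)"
      by (simp add: ip_simps power2_eq_square)
    then show ?thesis
      using hh mult_left_mono[OF vmax[OF g(1)], of "c\<^sup>2"] by (simp add: m_def mult.commute)
  qed
  have "\<forall>x\<in>V. adj_op v x = m * v x"
    by (rule null_vector_is_eigen[OF bound inv vC]) (simp_all add: v1 m_def)
  moreover have "\<exists>x\<in>V. v x \<noteq> 0"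
    using v1 ip_self_eq_0[of v] by auto
  ultimately have "eigenfun m v"
    by (simp add: eigenfun_def)
  then show thesis
    using that vC bound by blast
qed

end

section \<open>The Perron vector and the rank-one identity\<close>

locale three_eigenvalues = fin_graph +
  fixes th t :: real
  assumes connected: "Z \<subseteq> V \<Longrightarrow> Z \<noteq> {} \<Longrightarrow> (\<And>x. x \<in> Z \<Longrightarrow> nb x \<subseteq> Z) \<Longrightarrow> Z = V"
    and eigenvalues: "(\<exists>f. eigenfun l f) \<longleftrightarrow> l \<in> {th, 1, - t}"
    and th: "th > 1" and t: "- t < 1"
begin

text \<open>The maximum of the Rayleigh quotient on the whole space is an eigenvalue, and
  \<open>th\<close> is the largest one.\<close>

lemma rayleigh_bound: "ip h (adj_op h) \<le> th * ip h h"
proof (cases "ip h h = 0")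
  case True
  then show ?thesis
    by (simp add: ip_self_eq_0) (simp add: ip_def)
next
  case False
  then obtain m v where v: "eigenfun m v" and m: "\<And>h. h \<in> orth {} \<Longrightarrow> ip h (adj_op h) \<le> m * ip h h"
    by (rule max_eigenfun[of "{}" h, rotated 2]) (auto simp: orth_def)
  have "m \<le> th"
    using v eigenvalues[of m] th t by auto
  then show ?thesis
    using m[of h] mult_right_mono[OF _ ip_self_nonneg[of h], of m th] by (simp add: orth_def)
qed

text \<open>Replacing \<open>f\<close> by its absolute value cannot decrease the Rayleigh quotient,
  which is maximal already, so the absolute value is again an eigenfunction. At a zero of it all
  neighbours vanish too, and connectedness excludes zeros.\<close>

lemma perron:
  assumes f: "\<forall>x\<in>V. adj_op f x = th * f x" and ne: "\<exists>x\<in>V. f x \<noteq> 0"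
  shows "\<forall>x\<in>V. adj_op (\<lambda>x. \<bar>f x\<bar>) x = th * \<bar>f x\<bar>" and "\<forall>x\<in>V. f x \<noteq> 0"
proof -
  let ?p = "\<lambda>x. \<bar>f x\<bar>"
  have "ip f (adj_op f) \<le> ip ?p (adj_op ?p)"
    unfolding ip_def adj_op_def
  proof (rule sum_mono)
    fix x
    have "f x * sum f (nb x) \<le> \<bar>f x\<bar> * \<bar>sum f (nb x)\<bar>"
      by (metis abs_ge_self abs_mult)
    also have "\<dots> \<le> \<bar>f x\<bar> * (\<Sum>y\<in>nb x. \<bar>f y\<bar>)"
      by (intro mult_left_mono sum_abs) auto
    finally show "f x * sum f (nb x) \<le> \<bar>f x\<bar> * (\<Sum>y\<in>nb x. \<bar>f y\<bar>)" .
  qed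
  moreover have "ip f (adj_op f) = th * ip f f"
    using f ip_cong[of f f "adj_op f" "\<lambda>x. th * f x"] by (simp add: ip_simps)
  moreover have "ip f f = ip ?p ?p"
    by (simp add: ip_def)
  ultimately have "ip ?p (adj_op ?p) = th * ip ?p ?p"
    using rayleigh_bound[of ?p] by simp
  then show ev: "\<forall>x\<in>V. adj_op ?p x = th * ?p x"
    by (intro null_vector_is_eigen[of "{}"] rayleigh_bound) (auto simp: orth_def)
  let ?Z = "{x \<in> V. f x = 0}"
  have "nb x \<subseteq> ?Z" if "x \<in> ?Z" for x
  proof -
    have "(\<Sum>y\<in>nb x. \<bar>f y\<bar>) = 0"
      using ev that by (auto simp: adj_op_def)
    then show ?thesis
      using nb_subset by (auto simp: sum_nonneg_eq_0_iff)
  qed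
  then have "?Z = {}"
    using connected[of ?Z] ne by auto
  then show "\<forall>x\<in>V. f x \<noteq> 0"
    by auto
qed

definition shifted :: "real \<Rightarrow> ('a \<Rightarrow> real) \<Rightarrow> 'a \<Rightarrow> real" where
  "shifted c f = (\<lambda>x. adj_op f x - c * f x)"

lemma ip_shifted:
  assumes "\<forall>x\<in>V. adj_op v x = l * v x"
  shows "ip v (shifted c f) = (l - c) * ip v f"
proof -
  have "ip (adj_op v) f = ip (\<lambda>x. l * v x) f"
    using assms by (intro ip_cong) auto
  then show ?thesis
    by (simp add: shifted_def ip_simps adj_op_sym algebra_simps)
qed

text \<open>The product of the three factors maps every \<open>w\<close> to a function orthogonal to
  all eigenfunctions, since one factor kills each of them. The space of such functions is invariant,
  so if it were nonzero it would contain an eigenfunction, which would be orthogonal to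
  itself.\<close>

lemma annihilated:
  assumes "x \<in> V"
  shows "shifted th (shifted 1 (shifted (- t) w)) x = 0"
proof (rule ccontr)
  let ?u = "shifted th (shifted 1 (shifted (- t) w))"
  let ?C = "{v. \<exists>l. eigenfun l v}"
  assume "?u x \<noteq> 0"
  then have ne: "ip ?u ?u \<noteq> 0"
    using assms ip_self_eq_0 by blast
  have inv: "adj_op h \<in> orth ?C" if h: "h \<in> orth ?C" for h
  proof -
    have "ip v (adj_op h) = 0" if v: "eigenfun l v" for l v
      using ip_shifted[of v l 0 h] v h by (auto simp: eigenfun_def orth_def shifted_def)
    then show ?thesis
      by (auto simp: orth_def)
  qed
  have "?u \<in> orth ?C"
    unfolding orth_def
  proof (safe)
    fix v l assume v: "eigenfun l v"
    then have "l \<in> {th, 1, - t}"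
      using eigenvalues by blast
    moreover have "ip v ?u = (l - th) * ((l - 1) * ((l + t) * ip v w))"
      using v by (simp add: eigenfun_def ip_shifted[of v l])
    ultimately show "ip v ?u = 0"
      by auto
  qed
  from max_eigenfun[OF inv this ne] obtain m v where "v \<in> orth ?C" "eigenfun m v"
    by blast
  then show False
    using ip_self_eq_0[of v] by (auto simp: orth_def eigenfun_def)
qed

text \<open>By \<open>annihilated\<close>, the columns of \<open>(A - I)(A + tI)\<close> are
  multiples of the Perron vector; symmetry leaves one positive constant, whose square root is
  absorbed into \<open>al\<close>. The last conclusion bounds the adjacency form by the identity
  plus a correction along \<open>al\<close>, as used in \<open>k12_bound\<close>.\<close>

lemma rank_one:
  obtains al where "\<And>x. x \<in> V \<Longrightarrow> al x > 0"
    and "\<And>x. x \<in> V \<Longrightarrow> (\<Sum>y\<in>nb x. al y) = th * al x"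
    and "\<And>x y. x \<in> V \<Longrightarrow> y \<in> V \<Longrightarrow>
      real (card (nb x \<inter> nb y)) = al x * al y - (if E x y then t - 1 else 0) + (if x = y then t else 0)"
    and "\<And>h. ip h (adj_op h) \<le> ip h h + (ip al h)\<^sup>2 / (th + t)"
proof -
  obtain f where f: "eigenfun th f"
    using eigenvalues by blast
  define p where "p = (\<lambda>x. \<bar>f x\<bar>)"
  have pA: "\<forall>x\<in>V. adj_op p x = th * p x" and pos: "\<And>x. x \<in> V \<Longrightarrow> p x > 0"
    using perron[of f] f by (auto simp: eigenfun_def p_def)
  obtain x0 where x0: "x0 \<in> V"
    using f by (auto simp: eigenfun_def)
  \<comment> \<open>Simplicity of \<open>th\<close>: subtracting the multiple of \<open>p\<close>
    that agrees with \<open>g\<close> at \<open>x0\<close> leaves a solution with a zero, which by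
    \<open>perron\<close> vanishes everywhere.\<close>
  have mult: "g x = g x0 / p x0 * p x" if g: "\<forall>x\<in>V. adj_op g x = th * g x" and x: "x \<in> V" for g x
  proof -
    define c where "c = g x0 / p x0"
    let ?h = "\<lambda>x. g x - c * p x"
    have "\<forall>x\<in>V. adj_op ?h x = th * ?h x"
      using g pA by (simp add: adj_op_simps algebra_simps)
    moreover have "?h x0 = 0"
      using pos[OF x0] by (simp add: c_def)
    ultimately have "\<not> (\<exists>x\<in>V. ?h x \<noteq> 0)"
      using perron(2)[of ?h] x0 by blast
    then show ?thesis
      using x by (simp add: c_def)
  qed
  \<comment> \<open>\<open>d y\<close> is the unit vector at \<open>y\<close>, and
    \<open>M y\<close> the column at \<open>y\<close> of \<open>(A - I)(A + tI)\<close>, whose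
    entries count common neighbours.\<close>
  define d :: "'a \<Rightarrow> 'a \<Rightarrow> real" where "d = (\<lambda>y x. if x = y then 1 else 0)"
  define M where "M = (\<lambda>y. shifted 1 (shifted (- t) (d y)))"
  have ip_d: "ip g (d y) = g y" if "y \<in> V" for g y
    using that fin by (simp add: ip_def d_def if_distrib[of "\<lambda>u. _ * u"] cong: if_cong)
  have Ad: "adj_op (d y) x = (if E x y then 1 else 0)" if "y \<in> V" for x y
    using that by (auto simp: adj_op_def d_def in_nb)
  have Mval: "M y x = real (card (nb x \<inter> nb y)) + (if E x y then t - 1 else 0) - (if x = y then t else 0)"
    if "x \<in> V" "y \<in> V" for x y
  proof -
    have "adj_op (adj_op (d y)) x = (\<Sum>z\<in>nb x. if E z y then 1 else 0)"
      using Ad[OF that(2)] by (simp add: adj_op_def)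
    also have "\<dots> = real (card {z \<in> nb x. E z y})"
      by (simp add: sum.If_cases Int_def)
    also have "{z \<in> nb x. E z y} = nb x \<inter> nb y"
      using sym by (auto simp: in_nb)
    finally have AA: "adj_op (adj_op (d y)) x = real (card (nb x \<inter> nb y))" .
    show ?thesis
      using Ad[OF that(2)] AA
      by (simp add: M_def shifted_def adj_op_simps) (simp add: d_def algebra_simps)
  qed
  have "\<forall>x\<in>V. adj_op (M y) x = th * M y x" for y
    using annihilated by (simp add: M_def shifted_def[of th])
  then have Mp: "M y x = M y x0 / p x0 * p x" if "x \<in> V" for x y
    using mult that by blast
  have Msym: "M y x = M x y" if "x \<in> V" "y \<in> V" for x y
    using that sym by (auto simp: Mval Int_commute)
  define k where "k = M x0 x0 / (p x0)\<^sup>2"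
  have Mk: "M y x = k * p x * p y" if "x \<in> V" "y \<in> V" for x y
  proof -
    have "M y x = M x0 y / p x0 * p x"
      using Mp[of x y] Msym[of x0 y] that x0 by simp
    also have "\<dots> = k * p x * p y"
      using Mp[of y x0] that pos[OF x0] by (simp add: k_def power2_eq_square)
    finally show ?thesis .
  qed
  \<comment> \<open>Pairing a column with the Perron vector in two ways shows that \<open>k\<close>
    is positive.\<close>
  have "(th - 1) * (th + t) * p x0 = ip p (M x0)"
    by (simp add: M_def ip_shifted[OF pA] ip_d x0)
  also have "\<dots> = ip p (\<lambda>x. k * p x0 * p x)"
    using x0 by (intro ip_cong) (auto simp: Mk)
  finally have k: "(th - 1) * (th + t) = k * ip p p"
    using pos[OF x0] by (simp add: ip_simps)
  moreover have "ip p p > 0"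
    using ip_self_nonneg[of p] ip_self_eq_0[of p] x0 pos[OF x0] by force
  moreover have "(th - 1) * (th + t) > 0"
    using th t by simp
  ultimately have kpos: "k > 0"
    by (simp add: zero_less_mult_iff)
  define al where "al = (\<lambda>x. sqrt k * p x)"
  have al_pos: "al x > 0" if "x \<in> V" for x
    using that pos kpos by (simp add: al_def)
  have al_A: "\<forall>x\<in>V. adj_op al x = th * al x"
    using pA by (simp add: al_def adj_op_simps)
  have al_ip: "ip al al = (th - 1) * (th + t)"
    using kpos by (simp add: al_def ip_simps k)
  have al_M: "M y x = al x * al y" if "x \<in> V" "y \<in> V" for x y
    using kpos by (simp add: Mk[OF that] al_def algebra_simps)
  \<comment> \<open>On the complement of \<open>al\<close> the largest eigenvalue is not
    \<open>th\<close>, because a \<open>th\<close>-eigenfunction is a multiple of \<open>al\<close>;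
    so it is at most 1.\<close>
  have second: "ip h (adj_op h) \<le> ip h h" if h: "ip al h = 0" for h
  proof (cases "ip h h = 0")
    case True
    then show ?thesis
      by (simp add: ip_self_eq_0) (simp add: ip_def)
  next
    case False
    have inv: "adj_op g \<in> orth {al}" if "g \<in> orth {al}" for g
      using that ip_shifted[OF al_A, of 0 g] by (simp add: orth_def shifted_def)
    have "h \<in> orth {al}"
      using h by (simp add: orth_def)
    from max_eigenfun[OF inv this False] obtain m v where
      v: "v \<in> orth {al}" "eigenfun m v" and m: "\<And>h. h \<in> orth {al} \<Longrightarrow> ip h (adj_op h) \<le> m * ip h h"
      by blast
    have "m \<noteq> th"
    proof
      assume "m = th"
      then have "\<forall>x\<in>V. v x = v x0 / p x0 * p x"
        using mult[of v] v(2) by (auto simp: eigenfun_def)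
      then have "\<forall>x\<in>V. v x = v x0 / al x0 * al x"
        using kpos by (simp add: al_def)
      then have "ip al v = v x0 / al x0 * ip al al" and "v x0 \<noteq> 0"
        using v(2) unfolding ip_scale_right[symmetric] by (auto intro!: ip_cong simp: eigenfun_def)
      then have "ip al v \<noteq> 0"
        using al_pos[OF x0] al_ip th t by simp
      then show False
        using v(1) by (simp add: orth_def)
    qed
    then have "m \<le> 1"
      using v(2) eigenvalues[of m] t by auto
    then show ?thesis
      using m[of h] h mult_right_mono[OF _ ip_self_nonneg[of h], of m 1] by (simp add: orth_def)
  qed
  have "ip h (adj_op h) \<le> ip h h + (ip al h)\<^sup>2 / (th + t)" for h
  proof -
    define N where "N = (th - 1) * (th + t)"
    have al_N: "ip al al = N"
      by (simp add: N_def al_ip)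
    have N: "N > 0"
      using th t by (simp add: N_def)
    \<comment> \<open>\<open>c * al\<close> is the orthogonal projection of \<open>h\<close>; on it
      the form exceeds the identity by the factor \<open>th - 1\<close>, which yields the correction
      term.\<close>
    define c where "c = ip al h / N"
    define g where "g = (\<lambda>x. h x - c * al x)"
    have "ip al g = 0"
      unfolding g_def ip_diff_right ip_scale_right using N by (simp add: al_N c_def)
    then have "ip g (adj_op g) \<le> ip g g"
      by (rule second)
    moreover have al_h: "ip al h = c * N"
      using N by (simp add: c_def)
    moreover have "ip al (adj_op h) = th * (c * N)"
      using ip_shifted[OF al_A, of 0 h] al_h by (simp add: shifted_def)
    moreover have "ip h (adj_op al) = th * (c * N)"
      using calculation(3) by (metis adj_op_sym ip_commute)
    moreover have "ip al (adj_op al) = th * N"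
      using ip_shifted[OF al_A, of 0 al] by (simp add: shifted_def al_N)
    moreover have "ip g g = ip h h - 2 * c * (c * N) + c\<^sup>2 * N"
      using al_h by (simp add: g_def ip_simps al_N ip_commute[of h al] power2_eq_square algebra_simps)
    moreover have "ip g (adj_op g) = ip h (adj_op h) - 2 * c * (th * (c * N)) + c\<^sup>2 * (th * N)"
      using calculation by (simp add: g_def ip_simps adj_op_simps power2_eq_square algebra_simps)
    ultimately have "ip h (adj_op h) \<le> ip h h + (th - 1) * N * c\<^sup>2"
      by (simp add: power2_eq_square algebra_simps)
    moreover have "(c * N)\<^sup>2 / (th + t) = (th - 1) * N * c\<^sup>2"
    proof -
      have "(c * N)\<^sup>2 = (th - 1) * N * c\<^sup>2 * (th + t)"
        by (simp add: N_def power2_eq_square)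
      then show ?thesis
        using th t by simp
    qed
    ultimately show ?thesis
      by (simp add: al_h)
  qed
  moreover have "real (card (nb x \<inter> nb y)) = al x * al y - (if E x y then t - 1 else 0) + (if x = y then t else 0)"
    if "x \<in> V" "y \<in> V" for x y
    using al_M[OF that] Mval[OF that] by (simp split: if_splits)
  ultimately show thesis
    using that[of al] al_pos al_A by (simp add: adj_op_def)
qed

end

section \<open>Parameters of biregular graphs with second eigenvalue 1\<close>

text \<open>The quotient matrix has eigenvector \<open>(a, b)\<close> for \<open>th\<close>, so its
  trace minus \<open>th\<close> is the other eigenvalue. The equations \<open>sq\<close> are entries
  of its square, with the size \<open>n1\<close> of the first class unknown. The second claim
  compares the eigenvector equations with the valencies.\<close>

lemma quotient_eigenvalue:
  fixes a b :: real
  assumes ab: "0 < b" "b < a"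
    and q: "a * k11 + b * k12 = th * a" "a * k21 + b * k22 = th * b"
    and deg: "k11 + k12 = a\<^sup>2 + t" "k21 + k22 = b\<^sup>2 + t"
    and sq: "k11\<^sup>2 + k12 * k21 = n1 * a\<^sup>2 - (t - 1) * k11 + t" "k21 * (k11 + k22) = n1 * a * b - (t - 1) * k21"
  shows "k11 + k22 = th + 1 \<or> k11 + k22 = th - t" "k11 + k22 = th + t - a * b"
proof -
  define h where "h = k11 + k22 - th"
  have k22: "k22 = th + h - k11"
    by (simp add: h_def)
  have br: "b * k12 = a * (th - k11)" and as: "a * k21 = b * (k11 - h)"
    using q by (simp_all add: k22 algebra_simps)
  \<comment> \<open>This combination of the two equations in \<open>sq\<close> eliminates
    \<open>n1\<close>.\<close>
  have "b * (k11\<^sup>2 + k12 * k21) - a * (k21 * (k11 + k22)) = b * (- (t - 1) * k11 + t) + (t - 1) * (a * k21)"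
    unfolding sq by (simp add: algebra_simps power2_eq_square)
  moreover have "b * (k12 * k21) = a * k21 * (th - k11)"
    using arg_cong[OF br, of "\<lambda>u. u * k21"] by (simp only: mult_ac)
  ultimately have "b * k11\<^sup>2 + a * k21 * (th - k11) - a * k21 * (th + h) = b * (- (t - 1) * k11 + t) + (t - 1) * (a * k21)"
    by (simp add: k22 algebra_simps)
  then have "b * (h\<^sup>2 + (t - 1) * h - t) = 0"
    unfolding as by (simp add: algebra_simps power2_eq_square)
  then have "h\<^sup>2 + (t - 1) * h - t = 0"
    using ab by simp
  then have "(h - 1) * (h + t) = 0"
    by (simp add: algebra_simps power2_eq_square)
  then show "k11 + k22 = th + 1 \<or> k11 + k22 = th - t"
    by (auto simp: h_def)
  have "(a - b) * (k11 + k22) = (a - b) * (th + t - a * b)"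
  proof -
    have "k12 = a\<^sup>2 + t - k11" "k21 = b\<^sup>2 + t - k22"
      using deg by simp_all
    then have "a * k11 + b * (a\<^sup>2 + t - k11) = th * a" "a * (b\<^sup>2 + t - k22) + b * k22 = th * b"
      using q by simp_all
    then show ?thesis
      by (simp add: algebra_simps power2_eq_square)
  qed
  then show "k11 + k22 = th + t - a * b"
    using ab by simp
qed

text \<open>Concavity in \<open>s\<close>: the identity interpolates between the two endpoints of \<open>{B..B + t}\<close>.\<close>

lemma overlap_bound:
  fixes s B t :: real
  assumes "1 < t" "t \<le> B" "B < 2 * t" "B \<le> s" "s < B + t"
  shows "2 * t * B * (B - t + 1) < s * (4 * t * B + B - B * (B + t) - s * (2 * t - B))"
proof -
  let ?F = "\<lambda>s. s * (4 * t * B + B - B * (B + t) - s * (2 * t - B)) - 2 * t * B * (B - t + 1)"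
  have "t * ?F s = (B + t - s) * (B * (2 * t - B) * (t - 1)) + (s - B) * ((B - t) * (2 * t\<^sup>2 + B))
      + t * ((2 * t - B) * (s - B) * (B + t - s))"
    by (simp add: algebra_simps power2_eq_square)
  moreover have "0 < (B + t - s) * (B * (2 * t - B) * (t - 1))"
    using assms by (intro mult_pos_pos) auto
  moreover have "0 \<le> (s - B) * ((B - t) * (2 * t\<^sup>2 + B))"
    using assms by (intro mult_nonneg_nonneg) auto
  moreover have "0 \<le> t * ((2 * t - B) * (s - B) * (B + t - s))"
    using assms by (intro mult_nonneg_nonneg) auto
  ultimately have "0 < t * ?F s"
    by linarith
  then show ?thesis
    using assms by (simp add: zero_less_mult_iff)
qed

text \<open>From \<open>B < 2 * T\<close> and the product equation \<open>R > T\<close>, so the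
  quadratic inequality gives \<open>R * R < 5 * R\<close>, and only finitely many cases
  remain.\<close>

lemma parameters_of_fano:
  fixes T B R :: nat
  assumes "B * R = 2 * T\<^sup>2" "T \<le> B" "B < 2 * T" "2 \<le> B" "R\<^sup>2 \<le> 3 * R + 2 * T"
  shows "T = 2 \<and> B = 2 \<and> R = 4"
proof -
  have T: "T > 0"
    using assms by simp
  have "R > T"
  proof (rule ccontr)
    assume "\<not> R > T"
    then have "B * R \<le> B * T"
      by simp
    also have "\<dots> < 2 * T * T"
      using assms T by simp
    finally show False
      using assms by (simp add: power2_eq_square)
  qed
  then have "R * R < 5 * R"
    using assms(5) unfolding power2_eq_square by linarith
  then have R: "R < 5"
    by simp
  then have "R \<in> {0, 1, 2, 3, 4}" "T \<in> {1, 2, 3}"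
    using \<open>R > T\<close> T by auto
  then show ?thesis
    using assms \<open>R > T\<close> by (auto simp: power2_eq_square) presburger+
qed

section \<open>The equitable partition into the two valency classes\<close>

locale biregular_three = fin_graph +
  fixes al :: "'a \<Rightarrow> real" and th t a b :: real
  assumes perron_eq: "x \<in> V \<Longrightarrow> (\<Sum>y\<in>nb x. al y) = th * al x"
    and common: "x \<in> V \<Longrightarrow> y \<in> V \<Longrightarrow>
      real (card (nb x \<inter> nb y)) = al x * al y - (if E x y then t - 1 else 0) + (if x = y then t else 0)"
    and second: "ip h (adj_op h) \<le> ip h h + (ip al h)\<^sup>2 / (th + t)"
    and th: "th > 1" and t: "- t < 1"
    and al_values: "al ` V = {a, b}" and ab: "0 < b" "b < a"
begin

definition V1 where "V1 = {x \<in> V. al x = a}"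
definition V2 where "V2 = {x \<in> V. al x = b}"

lemma V_eq: "V = V1 \<union> V2" and disj: "V1 \<inter> V2 = {}"
  using al_values ab by (auto simp: V1_def V2_def)

lemma finite_parts [simp]: "finite V1" "finite V2"
  using fin by (auto simp: V1_def V2_def)

lemma parts_nonempty: "V1 \<noteq> {}" "V2 \<noteq> {}"
proof -
  have "a \<in> al ` V" "b \<in> al ` V"
    using al_values by auto
  then show "V1 \<noteq> {}" "V2 \<noteq> {}"
    by (auto simp: V1_def V2_def)
qed

lemma V1D: "x \<in> V1 \<Longrightarrow> x \<in> V" "x \<in> V1 \<Longrightarrow> al x = a"
  by (auto simp: V1_def)

lemma V2D: "x \<in> V2 \<Longrightarrow> x \<in> V" "x \<in> V2 \<Longrightarrow> al x = b"
  by (auto simp: V2_def)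

lemma cross_neq: "x \<in> V1 \<Longrightarrow> y \<in> V2 \<Longrightarrow> x \<noteq> y"
  using disj by auto

lemma degree: "x \<in> V \<Longrightarrow> real (card (nb x)) = (al x)\<^sup>2 + t"
  using common[of x x] irrefl by (simp add: power2_eq_square)

lemma common_adj: "x \<in> V \<Longrightarrow> y \<in> V \<Longrightarrow> E x y \<Longrightarrow> real (card (nb x \<inter> nb y)) = al x * al y - t + 1"
  using common[of x y] irrefl by auto

lemma common_nonadj: "x \<in> V \<Longrightarrow> y \<in> V \<Longrightarrow> x \<noteq> y \<Longrightarrow> \<not> E x y \<Longrightarrow> real (card (nb x \<inter> nb y)) = al x * al y"
  using common[of x y] by auto

lemma nb_split: "nb x = (nb x \<inter> V1) \<union> (nb x \<inter> V2)"
  using nb_subset[of x] V_eq by auto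

lemma sum_nb: "(\<Sum>y\<in>nb x. f y) = (\<Sum>y\<in>nb x \<inter> V1. f y) + (\<Sum>y\<in>nb x \<inter> V2. f y)"
  by (subst nb_split, rule sum.union_disjoint) (use disj in auto)

lemma card_nb: "card (nb x) = card (nb x \<inter> V1) + card (nb x \<inter> V2)"
  using sum_nb[of "\<lambda>_. 1 :: nat" x] by simp

lemma weighted_degree:
  assumes "x \<in> V"
  shows "a * real (card (nb x \<inter> V1)) + b * real (card (nb x \<inter> V2)) = th * al x"
proof -
  have "(\<Sum>y\<in>nb x \<inter> V1. al y) = (\<Sum>y\<in>nb x \<inter> V1. a)" "(\<Sum>y\<in>nb x \<inter> V2. al y) = (\<Sum>y\<in>nb x \<inter> V2. b)"
    by (auto intro!: sum.cong simp: V1D V2D)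
  then show ?thesis
    using perron_eq[OF assms] by (simp add: sum_nb mult.commute)
qed

text \<open>The two neighbour counts of a vertex solve two linear equations, from the valency and
  from the eigenvector \<open>al\<close>, with determinant \<open>a - b\<close> up to sign.\<close>

lemma equitable:
  assumes "x \<in> V" "y \<in> V" "al x = al y"
  shows "card (nb x \<inter> V1) = card (nb y \<inter> V1)" "card (nb x \<inter> V2) = card (nb y \<inter> V2)"
proof -
  have deg: "real (card (nb z \<inter> V1)) = (al z)\<^sup>2 + t - real (card (nb z \<inter> V2))" if "z \<in> V" for z
    using degree[OF that] card_nb[of z] by simp
  have "(a - b) * real (card (nb z \<inter> V2)) = a * ((al z)\<^sup>2 + t) - th * al z" if "z \<in> V" for z
    using weighted_degree[OF that] unfolding deg[OF that] by (simp add: algebra_simps)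
  from this[OF assms(1)] this[OF assms(2)] show "card (nb x \<inter> V2) = card (nb y \<inter> V2)"
    using ab assms(3) by (metis diff_gt_0_iff_gt less_irrefl mult_left_cancel of_nat_eq_iff)
  then show "card (nb x \<inter> V1) = card (nb y \<inter> V1)"
    using deg[OF assms(1)] deg[OF assms(2)] assms(3) by simp
qed

text \<open>The entries of the quotient matrix; \<open>equitable\<close> makes the choice of
  representative immaterial.\<close>

definition k11 where "k11 = card (nb (SOME x. x \<in> V1) \<inter> V1)"
definition k12 where "k12 = card (nb (SOME x. x \<in> V1) \<inter> V2)"
definition k21 where "k21 = card (nb (SOME x. x \<in> V2) \<inter> V1)"
definition k22 where "k22 = card (nb (SOME x. x \<in> V2) \<inter> V2)"

lemma card_nb_V1:
  assumes "x \<in> V1"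
  shows "card (nb x \<inter> V1) = k11" "card (nb x \<inter> V2) = k12"
proof -
  have "(SOME x. x \<in> V1) \<in> V1"
    using assms by (rule someI)
  then show "card (nb x \<inter> V1) = k11" "card (nb x \<inter> V2) = k12"
    using equitable[of x "SOME x. x \<in> V1"] assms by (simp_all add: k11_def k12_def V1D)
qed

lemma card_nb_V2:
  assumes "x \<in> V2"
  shows "card (nb x \<inter> V1) = k21" "card (nb x \<inter> V2) = k22"
proof -
  have "(SOME x. x \<in> V2) \<in> V2"
    using assms by (rule someI)
  then show "card (nb x \<inter> V1) = k21" "card (nb x \<inter> V2) = k22"
    using equitable[of x "SOME x. x \<in> V2"] assms by (simp_all add: k21_def k22_def V2D)
qed

lemma weighted: "a * k11 + b * k12 = th * a" "a * k21 + b * k22 = th * b"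
  and degrees: "real k11 + real k12 = a\<^sup>2 + t" "real k21 + real k22 = b\<^sup>2 + t"
proof -
  obtain x y where x: "x \<in> V1" and y: "y \<in> V2"
    using parts_nonempty by auto
  show "a * k11 + b * k12 = th * a" "real k11 + real k12 = a\<^sup>2 + t"
    using weighted_degree[of x] degree[of x] card_nb[of x] card_nb_V1[OF x] V1D[OF x] by simp_all
  show "a * k21 + b * k22 = th * b" "real k21 + real k22 = b\<^sup>2 + t"
    using weighted_degree[of y] degree[of y] card_nb[of y] card_nb_V2[OF y] V2D[OF y] by simp_all
qed

text \<open>Walks of length two from \<open>x\<close> into \<open>W\<close> are counted by their
  middle vertex and by their end.\<close>

lemma walk_count:
  assumes "x \<in> V" "W \<subseteq> V"
  shows "(\<Sum>w\<in>nb x. card (nb w \<inter> W)) = (\<Sum>z\<in>W. card (nb x \<inter> nb z))"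
proof -
  have fW: "finite W"
    using assms fin finite_subset by auto
  have "(\<Sum>w\<in>nb x. card (nb w \<inter> W)) = (\<Sum>w\<in>nb x. \<Sum>z\<in>W. if E w z then 1 else 0)"
    using assms fW by (intro sum.cong refl) (auto simp: sum.If_cases in_nb intro!: arg_cong[where f = card])
  also have "\<dots> = (\<Sum>z\<in>W. \<Sum>w\<in>nb x. if E w z then 1 else 0)"
    by (rule sum.swap)
  also have "\<dots> = (\<Sum>z\<in>W. card (nb x \<inter> nb z))"
    using assms sym by (intro sum.cong refl) (auto simp: sum.If_cases in_nb intro!: arg_cong[where f = card])
  finally show ?thesis .
qed

lemma walk_count':
  assumes x: "x \<in> V" and W: "W \<subseteq> V" and c: "\<And>z. z \<in> W \<Longrightarrow> al z = c"
  shows "real (\<Sum>w\<in>nb x. card (nb w \<inter> W))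
    = card W * (al x * c) - (t - 1) * card (nb x \<inter> W) + (if x \<in> W then t else 0)"
proof -
  have fW: "finite W"
    using assms fin finite_subset by auto
  have "real (\<Sum>w\<in>nb x. card (nb w \<inter> W))
      = (\<Sum>z\<in>W. al x * c - (if E x z then t - 1 else 0) + (if x = z then t else 0))"
    using W by (simp add: walk_count[OF x W] common[OF x] c subset_iff)
  also have "\<dots> = card W * (al x * c) - (\<Sum>z\<in>W. if E x z then t - 1 else 0) + (if x \<in> W then t else 0)"
    using fW by (simp add: sum.distrib sum_subtractf)
  also have "(\<Sum>z\<in>W. if E x z then t - 1 else 0) = (t - 1) * card (nb x \<inter> W)"
  proof -
    have "W \<inter> {z. E x z} = nb x \<inter> W"
      using W by (auto simp: in_nb)
    then show ?thesis
      using fW by (simp add: sum.If_cases)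
  qed
  finally show ?thesis .
qed

text \<open>Three entries of the square of the quotient matrix, evaluated through the
  common-neighbour formula.\<close>

lemma walks:
  "real k11 ^ 2 + real k12 * k21 = card V1 * a\<^sup>2 - (t - 1) * k11 + t"
  "real k21 * (real k11 + k22) = card V1 * a * b - (t - 1) * k21"
  "real k12 * (real k11 + k22) = card V2 * a * b - (t - 1) * k12"
proof -
  obtain x y where x: "x \<in> V1" and y: "y \<in> V2"
    using parts_nonempty by auto
  have sub: "V1 \<subseteq> V" "V2 \<subseteq> V"
    using V_eq by auto
  have nxy: "x \<notin> V2" "y \<notin> V1"
    using x y disj by auto
  have s: "(\<Sum>w\<in>nb x. card (nb w \<inter> V1)) = k11 * k11 + k12 * k21"
    "(\<Sum>w\<in>nb y. card (nb w \<inter> V1)) = k21 * k11 + k22 * k21"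
    "(\<Sum>w\<in>nb x. card (nb w \<inter> V2)) = k11 * k12 + k12 * k22"
    using x y by (simp_all add: sum_nb card_nb_V1 card_nb_V2)
  show "real k11 ^ 2 + real k12 * k21 = card V1 * a\<^sup>2 - (t - 1) * k11 + t"
    using walk_count'[of x V1 a] x sub s by (simp add: V1D card_nb_V1 power2_eq_square)
  show "real k21 * (real k11 + k22) = card V1 * a * b - (t - 1) * k21"
    using walk_count'[of y V1 a] y sub s nxy by (simp add: V1D V2D card_nb_V2 algebra_simps)
  show "real k12 * (real k11 + k22) = card V2 * a * b - (t - 1) * k12"
    using walk_count'[of x V2 b] x sub s nxy by (simp add: V1D V2D card_nb_V1 algebra_simps)
qed

text \<open>A nonadjacent pair across the classes has a common neighbour, which is adjacent to a
  vertex of the class other than its own.\<close>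

lemma cross_edge: obtains x y where "x \<in> V1" "y \<in> V2" "E x y"
proof -
  obtain x y where x: "x \<in> V1" and y: "y \<in> V2"
    using parts_nonempty by auto
  show thesis
  proof (cases "E x y")
    case False
    then have "real (card (nb x \<inter> nb y)) > 0"
      using common_nonadj[of x y] x y cross_neq[OF x y] ab by (simp add: V1D V2D)
    then obtain w where "w \<in> nb x \<inter> nb y"
      by (metis card_gt_0_iff ex_in_conv of_nat_0_less_iff)
    then have "w \<in> V" "E x w" "E w y"
      using sym by (auto simp: in_nb)
    moreover from \<open>w \<in> V\<close> have "w \<in> V1 \<or> w \<in> V2"
      using V_eq by auto
    ultimately show thesis
      using that x y by blast
  qed (use that x y in auto)
qed

lemma trace_quotient: "real k11 + k22 = th - t" and ab_eq: "a * b = 2 * t"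
proof -
  have q: "real k11 + k22 = th + 1 \<or> real k11 + k22 = th - t" "real k11 + k22 = th + t - a * b"
    using quotient_eigenvalue[OF ab weighted degrees walks(1,2)] by auto
  have "real k11 + k22 \<noteq> th + 1"
  proof
    assume *: "real k11 + k22 = th + 1"
    then have t_eq: "a * b = t - 1"
      using q(2) by simp
    obtain y where y: "y \<in> V2"
      using parts_nonempty by auto
    have "nb y \<inter> V2 = {}"
    proof (rule ccontr)
      assume "nb y \<inter> V2 \<noteq> {}"
      then obtain z where z: "z \<in> V2" "E y z"
        by (auto simp: in_nb)
      then have "real (card (nb y \<inter> nb z)) = b * b - a * b"
        using common_adj[of y z] y z t_eq by (simp add: V2D)
      also have "\<dots> < 0"
        using ab by simp
      finally show False
        by simp
    qed
    then have "k22 = 0"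
      using card_nb_V2(2)[OF y] by simp
    \<comment> \<open>With \<open>k22 = 0\<close> the trace forces \<open>k11 = th + 1\<close>, too
      large for the first equation in \<open>weighted\<close>.\<close>
    then have "a * k11 = a * th + a"
      using * by (simp add: distrib_left)
    moreover have "b * k12 \<ge> 0"
      using ab by simp
    ultimately show False
      using weighted(1) ab by (simp only: mult.commute[of th])
  qed
  then show "real k11 + k22 = th - t"
    using q(1) by simp
  then show "a * b = 2 * t"
    using q(2) by simp
qed

lemma t_pos: "t > 0"
  using ab_eq ab by (metis mult_pos_pos order.strict_trans zero_less_mult_iff zero_less_numeral less_asym)

lemma ab_ineqs: "b\<^sup>2 < 2 * t" "2 * t < a\<^sup>2"
  using ab ab_eq by (auto simp: power2_eq_square ab_eq[symmetric])

lemma a_sq: "a\<^sup>2 * b\<^sup>2 = 4 * t\<^sup>2"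
  using ab_eq by (metis four_x_squared power_mult_distrib)

lemma common_cross:
  assumes "x \<in> V1" "y \<in> V2"
  shows "real (card (nb x \<inter> nb y)) = (if E x y then t + 1 else 2 * t)"
  using assms common_adj[of x y] common_nonadj[of x y] cross_neq[of x y] ab_eq by (auto simp: V1D V2D)

lemma t_nat: obtains T :: nat where "t = real T"
proof -
  obtain x y where "x \<in> V1" "y \<in> V2" "E x y"
    by (rule cross_edge)
  then have "real (card (nb x \<inter> nb y)) = t + 1"
    using common_cross by simp
  then have "t = real (card (nb x \<inter> nb y) - 1)"
    using t_pos by (subst of_nat_diff) auto
  then show thesis
    using that by blast
qed

lemma b_sq_nat: obtains B :: nat where "b\<^sup>2 = real B"
proof -
  obtain T :: nat where T: "t = real T"
    by (rule t_nat)
  have "b\<^sup>2 = real (k21 + k22 - T)"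
    using degrees(2) T by (subst of_nat_diff) (auto, smt (verit) of_nat_add of_nat_le_iff zero_le_power2)
  then show thesis
    using that by blast
qed

text \<open>The ends of a cross edge have \<open>t + 1\<close> common neighbours, all among the
  other \<open>b\<^sup>2 + t - 1\<close> neighbours of the end in \<open>V2\<close>.\<close>

lemma b_sq_ge: "b\<^sup>2 \<ge> 2"
proof -
  obtain x y where x: "x \<in> V1" and y: "y \<in> V2" and xy: "E x y"
    by (rule cross_edge)
  have "nb x \<inter> nb y \<subseteq> nb y - {x}"
    using nb_irrefl by auto
  then have "card (nb x \<inter> nb y) \<le> card (nb y - {x})"
    by (intro card_mono) auto
  also have "\<dots> = card (nb y) - 1"
    using x xy sym by (simp add: in_nb V1D)
  finally have "real (card (nb x \<inter> nb y)) \<le> real (card (nb y) - 1)"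
    by simp
  also have "\<dots> = real (card (nb y)) - 1"
  proof -
    have "x \<in> nb y"
      using x xy sym by (simp add: in_nb V1D)
    then have "card (nb y) \<ge> 1"
      by (metis Suc_leI card_gt_0_iff empty_iff finite_nb One_nat_def)
    then show ?thesis
      by (simp add: of_nat_diff)
  qed
  finally show ?thesis
    using common_cross[OF x y] xy degree[of y] y by (simp add: V2D)
qed

lemma t_gt_1: "t > 1"
  using b_sq_ge ab_ineqs by simp

section \<open>Parameters in terms of \<open>t\<close>, \<open>b\<^sup>2\<close> and
  \<open>k21\<close>\<close>

lemma size_V1: "card V1 * (2 * t) = k21 * (th - 1)"
proof -
  have "card V1 * (a * b) = k21 * (th - 1)"
    using walks(2) unfolding trace_quotient by (simp add: algebra_simps)
  then show ?thesis
    by (simp only: ab_eq)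
qed

lemma size_V2: "card V2 * (2 * t) = k12 * (th - 1)"
proof -
  have "card V2 * (a * b) = k12 * (th - 1)"
    using walks(3) unfolding trace_quotient by (simp add: algebra_simps)
  then show ?thesis
    by (simp only: ab_eq)
qed

lemma th_eq: "b\<^sup>2 * th = b\<^sup>2 * (b\<^sup>2 + t) + k21 * (2 * t - b\<^sup>2)"
proof -
  have "b * (a * k21 + b * k22) = b * (th * b)"
    by (simp only: weighted)
  then have "2 * t * k21 + b\<^sup>2 * k22 = b\<^sup>2 * th"
    unfolding ab_eq[symmetric] by (simp add: algebra_simps power2_eq_square)
  moreover have "real k22 = b\<^sup>2 + t - k21"
    using degrees by simp
  ultimately show ?thesis
    by (simp add: algebra_simps)
qed

lemma k11_eq: "b\<^sup>2 * k11 = 2 * t * k21 - t * b\<^sup>2"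
proof -
  have "real k11 = th - t - (b\<^sup>2 + t - k21)"
    using trace_quotient degrees by simp
  then have "b\<^sup>2 * k11 = b\<^sup>2 * th - b\<^sup>2 * t - b\<^sup>2 * (b\<^sup>2 + t - k21)"
    by (simp only: right_diff_distrib)
  then show ?thesis
    unfolding th_eq by (simp add: algebra_simps)
qed

text \<open>Here \<open>k21\<close> is the size of \<open>V1\<close>, which fixes \<open>th\<close>.
  All of \<open>V1\<close> is adjacent to both ends of an edge inside \<open>V2\<close>, so
  \<open>b\<^sup>2\<close> is at least \<open>t\<close>; \<open>th_eq\<close> bounds it strictly
  below \<open>t + 1\<close>, and integrality leaves \<open>b\<^sup>2 = t\<close>.\<close>

lemma complete_join:
  assumes join: "\<And>x y. x \<in> V1 \<Longrightarrow> y \<in> V2 \<Longrightarrow> E x y"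
  shows "t = 2" "card V1 = 1" "card V2 = 10" "k22 = 3" "b\<^sup>2 = 2"
proof -
  obtain x y where x: "x \<in> V1" and y: "y \<in> V2"
    using parts_nonempty by auto
  obtain T :: nat where T: "t = real T"
    by (rule t_nat)
  obtain B :: nat where B: "b\<^sup>2 = real B"
    by (rule b_sq_nat)
  have nby: "nb z \<inter> V1 = V1" if "z \<in> V2" for z
    using that join sym by (auto simp: in_nb V1D)
  have "nb x \<inter> V2 = V2"
    using x join by (auto simp: in_nb V2D)
  then have k12: "card V2 = k12"
    using card_nb_V1(2)[OF x] by simp
  have k21: "card V1 = k21"
    using nby[OF y] card_nb_V2(1)[OF y] by simp
  have n1: "card V1 \<ge> 1"
    using parts_nonempty by (simp add: Suc_leI card_gt_0_iff)
  have th_val: "th = 2 * t + 1"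
    using size_V1 n1 unfolding k21 by simp
  have s_eq: "k21 * (2 * t - b\<^sup>2) = b\<^sup>2 * (t + 1 - b\<^sup>2)"
    using th_eq by (simp add: th_val algebra_simps)
  have "\<exists>u\<in>V2. \<exists>z\<in>V2. E u z"
  proof (rule ccontr)
    assume none: "\<not> (\<exists>u\<in>V2. \<exists>z\<in>V2. E u z)"
    then have nbV2: "nb z \<inter> V2 = {}" if "z \<in> V2" for z
      using that by (auto simp: in_nb)
    \<comment> \<open>Two vertices of a coclique \<open>V2\<close> would both have neighbourhood
      \<open>V1\<close>, hence \<open>b\<^sup>2 + t\<close> common neighbours instead of
      \<open>b\<^sup>2\<close>.\<close>
    have "V2 = {y}"
    proof (rule ccontr)
      assume "V2 \<noteq> {y}"
      then obtain z where z: "z \<in> V2" "z \<noteq> y"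
        using y by auto
      have "nb z = V1" "nb y = V1"
        using nb_split[of z] nb_split[of y] nby nbV2 z y by simp_all
      then have "nb y \<inter> nb z = nb y"
        by simp
      then show False
        using common_nonadj[of y z] degree[of y] z y none t_pos by (auto simp: V2D power2_eq_square)
    qed
    then have "k12 = 1"
      using k12 by simp
    moreover have "k22 = 0"
      using card_nb_V2(2)[OF y] nbV2[OF y] by simp
    ultimately have "a\<^sup>2 = 2"
      using degrees(1) trace_quotient th_val by simp
    then show False
      using ab_ineqs(2) t_gt_1 by simp
  qed
  then obtain u z where u: "u \<in> V2" and z: "z \<in> V2" and uz: "E u z"
    by auto
  have "V1 \<subseteq> nb u \<inter> nb z"
    using nby u z by auto
  then have "card V1 \<le> card (nb u \<inter> nb z)"
    by (intro card_mono) auto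
  then have le: "real (card V1) \<le> b\<^sup>2 - t + 1"
    using common_adj[of u z] u z uz by (simp add: V2D power2_eq_square)
  then have "b\<^sup>2 \<ge> t"
    using n1 by simp
  moreover have "b\<^sup>2 < t + 1"
  proof -
    have "0 < b\<^sup>2 * (t + 1 - b\<^sup>2)"
      unfolding s_eq[symmetric] using ab_ineqs n1 k21 by (intro mult_pos_pos) auto
    then show ?thesis
      using ab by (simp add: zero_less_mult_iff)
  qed
  ultimately have bt: "b\<^sup>2 = t"
    using T B by simp
  then have "k21 = 1"
    using s_eq t_pos by simp
  then have V1_1: "card V1 = 1"
    by (simp add: k21)
  then have "V1 = {x}"
    using x by (metis card_1_singletonE singletonD)
  then have "nb x \<inter> V1 = {}"
    using nb_irrefl by auto
  then have "k11 = 0"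
    using card_nb_V1(1)[OF x] by simp
  \<comment> \<open>The trace and the valency give two values of \<open>k22\<close>, whose equality
    determines \<open>t\<close>.\<close>
  then have "real k22 = t + 1"
    using trace_quotient th_val by simp
  moreover have "real k22 = 2 * t - 1"
    using degrees(2) bt \<open>k21 = 1\<close> by simp
  ultimately show t2: "t = 2"
    by simp
  show "k22 = 3"
    using \<open>real k22 = t + 1\<close> t2 by simp
  show "card V1 = 1"
    by (fact V1_1)
  show "b\<^sup>2 = 2"
    using bt t2 by simp
  have "a\<^sup>2 = 8"
    using a_sq bt t2 by simp
  then show "card V2 = 10"
    using degrees(1) \<open>k11 = 0\<close> t2 k12 by simp
qed

section \<open>A nonadjacent pair across the classes\<close>

context
  fixes x0 y0
  assumes x0: "x0 \<in> V1" and y0: "y0 \<in> V2" and nonadj: "\<not> E x0 y0"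
begin

lemma b_sq_ge_t: "b\<^sup>2 \<ge> t"
proof -
  have "card (nb x0 \<inter> nb y0) \<le> card (nb y0)"
    by (intro card_mono) auto
  then show ?thesis
    using common_cross[OF x0 y0] nonadj degree[of y0] y0 by (simp add: V2D)
qed

text \<open>A neighbour of \<open>y0\<close> in \<open>V1\<close> is one of the \<open>k11\<close>
  neighbours of \<open>x0\<close> in \<open>V1\<close> or one of the \<open>b\<^sup>2 - t\<close>
  neighbours of \<open>y0\<close> outside \<open>nb x0\<close>. After substituting
  \<open>k11_eq\<close>, the positive factor \<open>2 * t - b\<^sup>2\<close> cancels.\<close>

lemma k21_ge: "k21 \<ge> b\<^sup>2"
proof -
  have "nb y0 \<inter> V1 \<subseteq> (nb x0 \<inter> V1) \<union> (nb y0 - nb x0)"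
    by auto
  then have "card (nb y0 \<inter> V1) \<le> card ((nb x0 \<inter> V1) \<union> (nb y0 - nb x0))"
    by (intro card_mono) auto
  also have "\<dots> \<le> card (nb x0 \<inter> V1) + card (nb y0 - nb x0)"
    by (rule card_Un_le)
  finally have "k21 \<le> k11 + card (nb y0 - nb x0)"
    using card_nb_V1(1)[OF x0] card_nb_V2(1)[OF y0] by simp
  moreover have "card (nb y0 - nb x0) + card (nb x0 \<inter> nb y0) = card (nb y0)"
    using card_Int_Diff[of "nb y0" "nb x0"] by (simp add: Int_commute)
  ultimately have "real k21 \<le> k11 + b\<^sup>2 - t"
    using common_cross[OF x0 y0] nonadj degree[of y0] y0 by (simp add: V2D)
  then have "b\<^sup>2 * k21 \<le> b\<^sup>2 * (k11 + b\<^sup>2 - t)"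
    by (intro mult_left_mono) auto
  also have "\<dots> = b\<^sup>2 * k11 + b\<^sup>2 * (b\<^sup>2 - t)"
    by (simp add: algebra_simps)
  also have "\<dots> = 2 * t * k21 - b\<^sup>2 * (2 * t - b\<^sup>2)"
    unfolding k11_eq by (simp add: algebra_simps)
  finally have "b\<^sup>2 * (2 * t - b\<^sup>2) \<le> k21 * (2 * t - b\<^sup>2)"
    by (simp add: algebra_simps)
  then show ?thesis
    using ab_ineqs by simp
qed

text \<open>Adjacent vertices of \<open>V2\<close> have \<open>b\<^sup>2 - t + 1\<close> common
  neighbours, while their neighbourhoods in \<open>V1\<close> overlap in at least
  \<open>2 * k21 - card V1\<close> vertices. \<open>overlap_bound\<close> with
  \<open>s = k21\<close> makes this impossible.\<close>

lemma V2_coclique: "k22 = 0"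
proof (rule ccontr)
  assume ne: "k22 \<noteq> 0"
  then have "nb y0 \<inter> V2 \<noteq> {}"
    using card_nb_V2(2)[OF y0] by auto
  then obtain z where z: "z \<in> V2" and e: "E y0 z"
    by (auto simp: in_nb)
  have "card ((nb y0 \<inter> V1) \<union> (nb z \<inter> V1)) + card ((nb y0 \<inter> V1) \<inter> (nb z \<inter> V1)) = k21 + k21"
    using card_nb_V2(1)[OF y0] card_nb_V2(1)[OF z] card_Un_Int[of "nb y0 \<inter> V1" "nb z \<inter> V1"] by simp
  moreover have "card ((nb y0 \<inter> V1) \<union> (nb z \<inter> V1)) \<le> card V1"
    by (intro card_mono) auto
  moreover have "card ((nb y0 \<inter> V1) \<inter> (nb z \<inter> V1)) \<le> card (nb y0 \<inter> nb z)"
    by (intro card_mono) auto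
  ultimately have "2 * k21 \<le> card V1 + card (nb y0 \<inter> nb z)"
    by linarith
  then have "2 * real k21 \<le> card V1 + real (card (nb y0 \<inter> nb z))"
    by linarith
  then have "2 * real k21 - card V1 \<le> b\<^sup>2 - t + 1"
    using common_adj[of y0 z] y0 z e by (simp add: V2D power2_eq_square)
  then have "2 * t * b\<^sup>2 * (2 * real k21 - card V1) \<le> 2 * t * b\<^sup>2 * (b\<^sup>2 - t + 1)"
    using t_pos by (intro mult_left_mono) auto
  moreover have "2 * t * b\<^sup>2 * (2 * real k21 - card V1)
      = k21 * (4 * t * b\<^sup>2 + b\<^sup>2 - b\<^sup>2 * (b\<^sup>2 + t) - k21 * (2 * t - b\<^sup>2))"
  proof -
    have "2 * t * b\<^sup>2 * (2 * real k21 - card V1) = 4 * t * b\<^sup>2 * k21 - b\<^sup>2 * (card V1 * (2 * t))"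
      by (simp add: algebra_simps)
    also have "\<dots> = k21 * (4 * t * b\<^sup>2 + b\<^sup>2 - b\<^sup>2 * th)"
      unfolding size_V1 by (simp add: algebra_simps)
    finally show ?thesis
      unfolding th_eq by (simp add: algebra_simps)
  qed
  \<comment> \<open>The assumption \<open>k22 > 0\<close> supplies the strict upper bound
    \<open>k21 < b\<^sup>2 + t\<close>.\<close>
  ultimately show False
    using overlap_bound[OF t_gt_1 b_sq_ge_t ab_ineqs(1) k21_ge] degrees(2) ne by simp
qed

lemma coclique_parameters:
  "real k21 = b\<^sup>2 + t" "b\<^sup>2 * k12 = 2 * t\<^sup>2" "th = 2 * t + k12" "real k11 = th - t"
proof -
  show k21: "real k21 = b\<^sup>2 + t" and k11: "real k11 = th - t"
    using degrees(2) trace_quotient V2_coclique by simp_all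
  have bth: "b\<^sup>2 * th = 2 * t * (b\<^sup>2 + t)"
    using th_eq by (simp add: k21 algebra_simps)
  have r: "real k12 = a\<^sup>2 + 2 * t - th"
    using degrees(1) k11 by simp
  then have "b\<^sup>2 * k12 = b\<^sup>2 * (a\<^sup>2 + 2 * t - th)"
    by (simp only:)
  then have "b\<^sup>2 * k12 = a\<^sup>2 * b\<^sup>2 + 2 * t * b\<^sup>2 - b\<^sup>2 * th"
    by (simp add: algebra_simps)
  then show r2: "b\<^sup>2 * k12 = 2 * t\<^sup>2"
    unfolding a_sq bth by (simp add: algebra_simps power2_eq_square)
  have "b\<^sup>2 * th = b\<^sup>2 * (2 * t + k12)"
    unfolding bth distrib_left r2 by (simp add: algebra_simps power2_eq_square)
  then show "th = 2 * t + k12"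
    using ab by simp
qed

text \<open>
  The form \<open>I - A + \<alpha> \<alpha>\<^sup>T / (\<theta>\<^sub>0 + t)\<close> is nonnegative; its restriction to the span of a vertex
  of \<open>V1\<close>, its neighbours in \<open>V2\<close> and the remaining vertices of \<open>V2\<close> is minimised at the
  coefficients \<open>1\<close>, \<open>1 + l\<close>, \<open>l\<close>.
\<close>

lemma k12_bound: "real k12 ^ 2 \<le> 3 * k12 + 2 * t"
proof -
  define r where "r = real k12"
  define n where "n = real (card V2)"
  \<comment> \<open>By \<open>coclique_parameters\<close> this is \<open>th\<close>, written so that
    the size of \<open>V2\<close> becomes a multiple of \<open>D - 1\<close>.\<close>
  define D where "D = 2 * t + r"
  define l where "l = - 2 * t / D"
  have r0: "r \<ge> 0"
    by (simp add: r_def)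
  then have D: "D > 0"
    using t_pos by (simp add: D_def)
  define h where "h = (\<lambda>z. (if z = x0 then 1 else 0) + (if z \<in> nb x0 \<inter> V2 then 1 else 0)
    + (if z \<in> V2 then l else 0))"
  have x0V: "x0 \<in> V" "x0 \<notin> V2"
    using x0 disj by (auto simp: V1D)
  have coc: "nb z \<inter> V2 = {}" if "z \<in> V2" for z
    using card_nb_V2(2)[OF that] V2_coclique by (simp add: card_eq_0_iff)
  have sumV: "(\<Sum>z\<in>V. h z * g z) = g x0 + (\<Sum>z\<in>nb x0 \<inter> V2. g z) + l * (\<Sum>z\<in>V2. g z)" for g :: "_ \<Rightarrow> real"
  proof -
    have "(\<Sum>z\<in>V. h z * g z) = (\<Sum>z\<in>V. if z = x0 then g z else 0) + (\<Sum>z\<in>V. if z \<in> nb x0 \<inter> V2 then g z else 0)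
        + (\<Sum>z\<in>V. if z \<in> V2 then l * g z else 0)"
      unfolding sum.distrib[symmetric] by (intro sum.cong refl) (simp add: h_def distrib_right)
    also have "(\<Sum>z\<in>V. if z = x0 then g z else 0) = g x0"
      using fin x0V by simp
    also have "(\<Sum>z\<in>V. if z \<in> nb x0 \<inter> V2 then g z else 0) = (\<Sum>z\<in>nb x0 \<inter> V2. g z)"
      using fin nb_subset by (subst sum.inter_restrict[symmetric]) (auto intro!: sum.cong)
    also have "(\<Sum>z\<in>V. if z \<in> V2 then l * g z else 0) = l * (\<Sum>z\<in>V2. g z)"
      using fin V_eq by (subst sum.inter_restrict[symmetric]) (auto intro!: sum.cong simp: sum_distrib_left)
    finally show ?thesis .
  qed
  have hx0: "h x0 = 1"
    using x0V by (simp add: h_def)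
  have h_nb: "h z = 1 + l" if "z \<in> nb x0 \<inter> V2" for z
    using that x0V by (auto simp: h_def)
  have h_V2: "h z = (if z \<in> nb x0 \<inter> V2 then 1 else 0) + l" if "z \<in> V2" for z
    using that x0V by (auto simp: h_def)
  have card_r: "real (card (nb x0 \<inter> V2)) = r"
    using card_nb_V1(2)[OF x0] by (simp add: r_def)
  then have card_r': "real (card (V2 \<inter> nb x0)) = r"
    by (simp add: Int_commute)
  have Int: "V2 \<inter> {z. z \<in> nb x0 \<and> z \<in> V2} = nb x0 \<inter> V2"
    by auto
  have sum_h_V2: "(\<Sum>z\<in>V2. h z) = r + l * n"
    by (simp add: h_V2 sum.distrib sum.If_cases n_def Int card_r card_r' cong: sum.cong)
  have hh: "ip h h = 1 + r * (1 + l) + l * (r + l * n)"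
    unfolding ip_def sumV by (simp add: hx0 sum_h_V2 h_nb card_r)
  have Ah_x0: "adj_op h x0 = r * (1 + l)"
  proof -
    have "h z = 0" if "z \<in> nb x0 \<inter> V1" for z
      using that nb_irrefl disj by (auto simp: h_def)
    then show ?thesis
      by (simp add: adj_op_def sum_nb h_nb card_r)
  qed
  \<comment> \<open>Since \<open>V2\<close> is a coclique and \<open>h\<close> vanishes on
    \<open>V1\<close> except at \<open>x0\<close>, only \<open>x0\<close> contributes.\<close>
  have Ah_V2: "adj_op h z = (if z \<in> nb x0 \<inter> V2 then 1 else 0)" if z: "z \<in> V2" for z
  proof -
    have "adj_op h z = (\<Sum>w\<in>nb z \<inter> V1. h w)"
      by (simp add: adj_op_def sum_nb coc[OF z])
    also have "\<dots> = (\<Sum>w\<in>nb z \<inter> V1. if w = x0 then 1 else 0)"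
      using disj by (intro sum.cong refl) (auto simp: h_def)
    also have "\<dots> = (if x0 \<in> nb z \<inter> V1 then 1 else 0)"
      by simp
    also have "\<dots> = (if z \<in> nb x0 \<inter> V2 then 1 else 0)"
      using x0 z sym by (auto simp: in_nb V1D V2D)
    finally show ?thesis .
  qed
  have Ah_nb: "adj_op h z = 1" if "z \<in> nb x0 \<inter> V2" for z
    using that Ah_V2[of z] by simp
  have sum_Ah: "(\<Sum>z\<in>nb x0 \<inter> V2. adj_op h z) = r"
    by (simp add: Ah_nb card_r)
  have hAh: "ip h (adj_op h) = 2 * r * (1 + l)"
    unfolding ip_def sumV sum_Ah
    by (simp add: Ah_x0 Ah_V2 card_r card_r' sum.If_cases Int algebra_simps cong: sum.cong)
  have al_h: "ip al h = a + b * r + l * b * n"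
    unfolding ip_commute[of al] unfolding ip_def sumV using x0
    by (simp add: V1D V2D card_r n_def)
  have c: "b\<^sup>2 * r = 2 * t\<^sup>2" "th = 2 * t + r"
    using coclique_parameters by (simp_all add: r_def)
  have n_eq: "n * (2 * t) = r * (D - 1)"
    using size_V2 by (simp add: n_def r_def D_def c)
  have lD: "l * D = - 2 * t"
    using D by (simp add: l_def)
  \<comment> \<open>The terms linear in \<open>l\<close> cancel between
    \<open>ip h (adj_op h)\<close> and \<open>ip h h\<close>.\<close>
  have "r - 1 \<le> n * l\<^sup>2 + (ip al h)\<^sup>2 / (th + t)"
    using second[of h] by (simp add: hh hAh algebra_simps power2_eq_square)
  also have "n * l\<^sup>2 = 2 * t * r * (D - 1) / D\<^sup>2"
  proof -
    have "n * l\<^sup>2 * D\<^sup>2 = n * (l * D)\<^sup>2"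
      by (simp add: power_mult_distrib)
    also have "\<dots> = 2 * t * (n * (2 * t))"
      unfolding lD by (simp add: power2_eq_square)
    also have "\<dots> = 2 * t * r * (D - 1)"
      unfolding n_eq by simp
    finally show ?thesis
      using D by (simp add: field_simps)
  qed
  also have "(ip al h)\<^sup>2 / (th + t) = 2 * r * (t + D) / D\<^sup>2"
  proof -
    have bn: "b\<^sup>2 * n = t * (D - 1)"
    proof -
      have "2 * t * (b\<^sup>2 * n) = b\<^sup>2 * (n * (2 * t))"
        by simp
      also have "\<dots> = 2 * t * (t * (D - 1))"
        unfolding n_eq using c(1) by (simp add: power2_eq_square algebra_simps)
      finally show ?thesis
        using t_pos by simp
    qed
    have "D * (b * ip al h) = D * (a * b + b\<^sup>2 * r) + (l * D) * (b\<^sup>2 * n)"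
      by (simp add: al_h algebra_simps power2_eq_square)
    also have "\<dots> = 2 * t * (t + D)"
      unfolding lD bn c(1) ab_eq by (simp add: algebra_simps power2_eq_square)
    finally have "(D * (b * ip al h))\<^sup>2 = (2 * t * (t + D))\<^sup>2"
      by simp
    then have "D\<^sup>2 * b\<^sup>2 * (ip al h)\<^sup>2 = 2 * (2 * t\<^sup>2) * (t + D)\<^sup>2"
      by (simp add: power_mult_distrib)
    also have "\<dots> = b\<^sup>2 * (2 * r * (t + D)\<^sup>2)"
      unfolding c(1)[symmetric] by simp
    finally have "D\<^sup>2 * (ip al h)\<^sup>2 = 2 * r * (t + D)\<^sup>2"
      using ab by simp
    moreover have "th + t = t + D"
      by (simp add: c D_def)
    ultimately have "(ip al h)\<^sup>2 = 2 * r * (t + D) / D\<^sup>2 * (th + t)"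
      using D by (simp add: field_simps power2_eq_square)
    then show ?thesis
      using th t by simp
  qed
  also have "2 * t * r * (D - 1) / D\<^sup>2 + 2 * r * (t + D) / D\<^sup>2 = 2 * r * (t + 1) / D"
  proof -
    have "2 * t * r * (D - 1) + 2 * r * (t + D) = 2 * r * (t + 1) * D"
      by (simp add: algebra_simps)
    then show ?thesis
      using D by (simp add: add_divide_distrib[symmetric] power2_eq_square)
  qed
  finally have "(r - 1) * D \<le> 2 * r * (t + 1)"
    using D by (simp add: field_simps)
  then have "r\<^sup>2 \<le> 3 * r + 2 * t"
    by (simp add: D_def algebra_simps power2_eq_square)
  then show ?thesis
    by (simp add: r_def)
qed

lemma fano_parameters:
  "t = 2" "b\<^sup>2 = 2" "k11 = 6" "k12 = 4" "k21 = 4" "card V1 = 7" "card V2 = 7"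
proof -
  obtain T :: nat where T: "t = real T"
    by (rule t_nat)
  obtain B :: nat where B: "b\<^sup>2 = real B"
    by (rule b_sq_nat)
  have "real (B * k12) = real (2 * T\<^sup>2)" "T \<le> B" "real B < real (2 * T)" "2 \<le> B" "real (k12\<^sup>2) \<le> real (3 * k12 + 2 * T)"
    using coclique_parameters b_sq_ge_t b_sq_ge ab_ineqs k12_bound by (simp_all add: T B)
  then have "T = 2 \<and> B = 2 \<and> k12 = 4"
    by (intro parameters_of_fano) (simp_all only: of_nat_eq_iff of_nat_le_iff of_nat_less_iff)
  then show tb: "t = 2" "b\<^sup>2 = 2" and r: "k12 = 4"
    using T B by auto
  then have "th = 8"
    using coclique_parameters(3) by simp
  then show "k11 = 6" and s: "k21 = 4" "card V1 = 7" "card V2 = 7"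
    using coclique_parameters(1,4) size_V1 size_V2 tb r by simp_all
qed

end

end

section \<open>Uniqueness of the Fano plane and of the Petersen graph\<close>

text \<open>The labellings constructed later run from the concrete graph to the given one, so the
  isomorphism is the inverse of \<open>h\<close>, acting on arcs componentwise.\<close>

lemma digraph_isoI:
  assumes wf: "pair_wf_digraph G" "pair_wf_digraph H"
    and h: "bij_betw h (pverts H) (pverts G)"
    and arcs: "\<And>u v. u \<in> pverts H \<Longrightarrow> v \<in> pverts H \<Longrightarrow> (h u, h v) \<in> parcs G \<longleftrightarrow> (u, v) \<in> parcs H"
  shows "digraph_iso (with_proj G) (with_proj H)"
proof -
  interpret G: pair_wf_digraph G by fact
  interpret H: pair_wf_digraph H by fact
  define f where "f = inv_into (pverts H) h"
  have f: "bij_betw f (pverts G) (pverts H)"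
    unfolding f_def using h by (rule bij_betw_inv_into)
  have hf: "h (f x) = x" if "x \<in> pverts G" for x
    using that h by (auto simp: f_def bij_betw_def f_inv_into_f)
  have fh: "f (h u) = u" if "u \<in> pverts H" for u
    using that h by (auto simp: f_def bij_betw_def)
  have fV: "f x \<in> pverts H" if "x \<in> pverts G" for x
    using f that by (auto simp: bij_betw_def)
  have hV: "h u \<in> pverts G" if "u \<in> pverts H" for u
    using h that by (auto simp: bij_betw_def)
  let ?f = "\<lparr>iso_verts = f, iso_arcs = map_prod f f, iso_head = snd, iso_tail = fst\<rparr>"
  have inj: "inj_on f (pverts G)"
    using f by (simp add: bij_betw_def)
  have sub: "parcs G \<subseteq> pverts G \<times> pverts G"
    by (auto dest: G.in_arcsD1 G.in_arcsD2)
  have "inj_on (map_prod f f) (parcs G)"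
    using map_prod_inj_on[OF inj inj] sub by (rule inj_on_subset)
  then have iso: "G.digraph_isomorphism ?f"
    using inj by (simp add: G.digraph_isomorphism_def G.wf_digraph_axioms)
  have "map_prod f f ` parcs G = parcs H"
  proof (intro subset_antisym subsetI)
    fix e assume "e \<in> map_prod f f ` parcs G"
    then obtain x y where "(x, y) \<in> parcs G" "e = (f x, f y)"
      by auto
    moreover from this have "x \<in> pverts G" "y \<in> pverts G"
      using sub by auto
    ultimately show "e \<in> parcs H"
      using arcs[of "f x" "f y"] by (simp add: hf fV)
  next
    fix e assume "e \<in> parcs H"
    then obtain u v where uv: "(u, v) \<in> parcs H" "e = (u, v)"
      by (cases e) auto
    then have "u \<in> pverts H" "v \<in> pverts H"
      using H.in_arcsD1 H.in_arcsD2 by simp_all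
    then have "(h u, h v) \<in> parcs G" "e = map_prod f f (h u, h v)"
      using arcs uv by (auto simp: fh)
    then show "e \<in> map_prod f f ` parcs G"
      by blast
  qed
  then have "with_proj H = app_iso ?f (with_proj G)"
    using f by (simp add: app_iso_def with_proj_def bij_betw_def)
  then show ?thesis
    using iso by (auto simp: digraph_iso_def)
qed

section \<open>Uniqueness of the Fano plane\<close>

lemma less_7: "{..<7::nat} = {0, 1, 2, 3, 4, 5, 6}"
  by auto

lemma fano_lines_eq:
  "fano_lines = {{0,1,3}, {1,2,4}, {2,3,5}, {3,4,6}, {4,5,0}, {5,6,1}, {6,0,2}}"
  by (simp add: fano_lines_def less_7 insert_commute numeral_2_eq_2[symmetric])

lemma fano_lines_subset: "L \<in> fano_lines \<Longrightarrow> L \<subseteq> {..<7}"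
  by (auto simp: fano_lines_eq)

text \<open>The seven lines have pairwise different sums.\<close>

lemma card_fano_lines: "card fano_lines = 7"
proof (rule antisym)
  have "card fano_lines \<le> card {..<7::nat}"
    unfolding fano_lines_def by (rule card_image_le) simp
  then show "card fano_lines \<le> 7"
    by simp
  have "sum id ` fano_lines = {4, 7, 10, 13, 9, 12, 8}"
    unfolding fano_lines_eq by simp
  then have "card (sum id ` fano_lines) = 7"
    by simp
  moreover have "finite fano_lines"
    by (simp add: fano_lines_def)
  ultimately show "7 \<le> card fano_lines"
    using card_image_le[of fano_lines "sum id"] by simp
qed

text \<open>Points are named after the model with lines \<open>{i, i+1, i+3}\<close> modulo 7. Two
  points and a third one off their line determine the names of the others by completing lines, and
  the remaining lines follow by exclusion.\<close>

lemma fano_plane_unique: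
  assumes P: "card P = 7" and L: "finite \<L>" "card \<L> \<le> 7"
    and line: "\<And>l. l \<in> \<L> \<Longrightarrow> l \<subseteq> P \<and> card l = 3"
    and join: "\<And>p q. p \<in> P \<Longrightarrow> q \<in> P \<Longrightarrow> p \<noteq> q \<Longrightarrow> \<exists>l\<in>\<L>. p \<in> l \<and> q \<in> l"
    and meet: "\<And>p q l m. p \<noteq> q \<Longrightarrow> l \<in> \<L> \<Longrightarrow> m \<in> \<L> \<Longrightarrow> p \<in> l \<Longrightarrow> q \<in> l \<Longrightarrow> p \<in> m \<Longrightarrow> q \<in> m \<Longrightarrow> l = m"
  obtains p :: "nat \<Rightarrow> 'a" where "bij_betw p {..<7} P" "(\<lambda>l. p ` l) ` fano_lines = \<L>"
proof -
  have third: "\<exists>r\<in>P. r \<noteq> p \<and> r \<noteq> q \<and> {p, q, r} \<in> \<L>" if pq: "p \<in> P" "q \<in> P" "p \<noteq> q" for p q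
  proof -
    obtain l where l: "l \<in> \<L>" "p \<in> l" "q \<in> l"
      using join[OF pq] by auto
    then have "card (l - {p, q}) = 1"
      using pq(3) line[OF l(1)] by (subst card_Diff_subset) auto
    then obtain r where r: "l - {p, q} = {r}"
      by (auto simp: card_1_singleton_iff)
    then have "l = {p, q, r}"
      using l by auto
    then show ?thesis
      using l line r by auto
  qed
  obtain p0 p1 where p01: "p0 \<in> P" "p1 \<in> P" "p0 \<noteq> p1"
  proof -
    have "\<not> card P \<le> 1"
      using P by simp
    then show thesis
      using that card_le_Suc0_iff_eq[of P] P by (metis One_nat_def card.infinite zero_neq_numeral)
  qed
  obtain p3 where p3: "p3 \<in> P" "p3 \<noteq> p0" "p3 \<noteq> p1" "{p0, p1, p3} \<in> \<L>"
    using third[of p0 p1] p01 by auto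
  obtain p2 where p2: "p2 \<in> P" "p2 \<notin> {p0, p1, p3}"
  proof -
    have "card {p0, p1, p3} \<le> 3"
      by (simp add: card_insert_if)
    then have "\<not> P \<subseteq> {p0, p1, p3}"
      using card_mono[of "{p0, p1, p3}" P] P by auto
    then show thesis
      using that by auto
  qed
  obtain p4 where p4: "p4 \<in> P" "p4 \<noteq> p1" "p4 \<noteq> p2" "{p1, p2, p4} \<in> \<L>"
    using third[of p1 p2] p01 p2 by auto
  obtain p5 where p5: "p5 \<in> P" "p5 \<noteq> p2" "p5 \<noteq> p3" "{p2, p3, p5} \<in> \<L>"
    using third[of p2 p3] p3 p2 by auto
  obtain p6 where p6: "p6 \<in> P" "p6 \<noteq> p0" "p6 \<noteq> p2" "{p0, p2, p6} \<in> \<L>"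
    using third[of p0 p2] p01 p2 by auto
  \<comment> \<open>Distinct lines cannot share two points; this form excludes all coincidences
    between names below.\<close>
  have apart: False
    if "l \<in> \<L>" "m \<in> \<L>" "x \<in> l" "x \<in> m" "y \<in> l" "y \<in> m" "x \<noteq> y" "z \<in> l" "z \<notin> m" for l m x y z
    using meet[of x y l m] that by auto
  have d4: "p4 \<noteq> p0" "p4 \<noteq> p3"
    using apart[OF p4(4) p3(4), of p1 p4 p2] p2 p4 by auto
  have d5: "p5 \<noteq> p0" "p5 \<noteq> p1"
    using apart[OF p5(4) p3(4), of p3 p5 p2] p2 p5 by auto
  have d6: "p6 \<noteq> p1" "p6 \<noteq> p3"
    using apart[OF p6(4) p3(4), of p0 p6 p2] p2 p6 by auto
  have d45: "p4 \<noteq> p5"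
    using apart[OF p4(4) p5(4), of p2 p4 p1] p01 p2 p3 p4 p5 d5 by auto
  have d46: "p4 \<noteq> p6"
    using apart[OF p4(4) p6(4), of p2 p4 p1] p01 p2 p3 p4 d6 by auto
  have d56: "p5 \<noteq> p6"
    using apart[OF p5(4) p6(4), of p2 p5 p3] p01 p2 p3 p5 d6 by auto
  note distinct = p01(3) p3(2,3) p2(2) p4(2,3) p5(2,3) p6(2,3) d4 d5 d6 d45 d46 d56
  have P_eq: "P = {p0, p1, p2, p3, p4, p5, p6}"
  proof (rule sym, rule card_subset_eq)
    show "finite P"
      using P card.infinite by force
    show "{p0, p1, p2, p3, p4, p5, p6} \<subseteq> P"
      using p01 p2 p3 p4 p5 p6 by auto
    show "card {p0, p1, p2, p3, p4, p5, p6} = card P"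
      using distinct P by auto
  qed
  \<comment> \<open>The line through \<open>p3\<close> and \<open>p4\<close> has a third point;
    every candidate other than \<open>p6\<close> lies on a known line with one of these two
    points.\<close>
  have l3: "{p3, p4, p6} \<in> \<L>"
  proof -
    obtain r where r: "r \<in> P" "r \<noteq> p3" "r \<noteq> p4" "{p3, p4, r} \<in> \<L>"
      using third[of p3 p4] p3 p4 d4 by auto
    have "r \<noteq> p0"
      using apart[OF p3(4) r(4), of p3 p0 p1] distinct by auto
    moreover have "r \<noteq> p1"
      using apart[OF p3(4) r(4), of p3 p1 p0] distinct by auto
    moreover have "r \<noteq> p2"
      using apart[OF p5(4) r(4), of p3 p2 p5] distinct by auto
    moreover have "r \<noteq> p5"
      using apart[OF p5(4) r(4), of p3 p5 p2] distinct by auto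
    ultimately show ?thesis
      using r P_eq by auto
  qed
  have l4: "{p4, p5, p0} \<in> \<L>"
  proof -
    obtain r where r: "r \<in> P" "r \<noteq> p4" "r \<noteq> p5" "{p4, p5, r} \<in> \<L>"
      using third[of p4 p5] p4 p5 d45 by auto
    have "r \<noteq> p1"
      using apart[OF p4(4) r(4), of p4 p1 p2] distinct by auto
    moreover have "r \<noteq> p2"
      using apart[OF p4(4) r(4), of p4 p2 p1] distinct by auto
    moreover have "r \<noteq> p3"
      using apart[OF p5(4) r(4), of p5 p3 p2] distinct by auto
    moreover have "r \<noteq> p6"
      using apart[OF l3 r(4), of p4 p6 p3] distinct by auto
    ultimately show ?thesis
      using r P_eq by auto
  qed
  have l5: "{p5, p6, p1} \<in> \<L>"
  proof -
    obtain r where r: "r \<in> P" "r \<noteq> p5" "r \<noteq> p6" "{p5, p6, r} \<in> \<L>"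
      using third[of p5 p6] p5 p6 d56 by auto
    have "r \<noteq> p0"
      using apart[OF p6(4) r(4), of p6 p0 p2] distinct by auto
    moreover have "r \<noteq> p2"
      using apart[OF p6(4) r(4), of p6 p2 p0] distinct by auto
    moreover have "r \<noteq> p3"
      using apart[OF p5(4) r(4), of p5 p3 p2] distinct by auto
    moreover have "r \<noteq> p4"
      using apart[OF l4 r(4), of p5 p4 p0] distinct by auto
    ultimately show ?thesis
      using r P_eq by auto
  qed
  define p where "p = (\<lambda>i::nat. [p0, p1, p2, p3, p4, p5, p6] ! i)"
  have pv: "p 0 = p0" "p (Suc 0) = p1" "p 2 = p2" "p 3 = p3" "p 4 = p4" "p 5 = p5" "p 6 = p6"
    by (simp_all add: p_def)
  have img: "p ` {..<7} = P"
    by (simp add: less_7 pv P_eq)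
  then have bij: "bij_betw p {..<7} P"
    using P by (simp add: bij_betw_def eq_card_imp_inj_on)
  \<comment> \<open>Seven distinct images lie in a set of at most seven lines, so they are all of
    them.\<close>
  have "(\<lambda>l. p ` l) ` fano_lines \<subseteq> \<L>"
    using p3 p4 p5 p6 l3 l4 l5 by (simp add: fano_lines_eq pv insert_commute)
  moreover have "inj_on (\<lambda>l. p ` l) fano_lines"
    using bij fano_lines_subset by (auto intro!: inj_onI simp: bij_betw_def inj_on_image_eq_iff)
  then have "card ((\<lambda>l. p ` l) ` fano_lines) = 7"
    by (simp add: card_image card_fano_lines)
  ultimately have "(\<lambda>l. p ` l) ` fano_lines = \<L>"
    using L by (intro card_subset_eq card_seteq) auto
  then show thesis
    using that bij by blast
qed

section \<open>Uniqueness of the Petersen graph\<close>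

definition pair_vertices :: "nat set set" where
  "pair_vertices = {A. A \<subseteq> {..<5} \<and> card A = 2}"

text \<open>The order of the list is that of the names
  \<open>v, a, b, c, a1, b1, c1, a2, b2, c2\<close> in \<open>petersen_unique\<close>.\<close>

lemma pair_vertices_eq:
  "pair_vertices = {{0,1}, {2,3}, {2,4}, {3,4}, {0,4}, {1,3}, {0,2}, {1,4}, {0,3}, {1,2}}"
proof (intro subset_antisym subsetI)
  fix A assume "A \<in> pair_vertices"
  then obtain x y where "A = {x, y}" "x \<noteq> y" "x < 5" "y < 5"
    by (auto simp: pair_vertices_def card_2_iff)
  then obtain x y where A: "A = {x, y}" and xy: "x < y" "y < 5"
    by (metis insert_commute linorder_neqE_nat)
  have "y = 1 \<or> y = 2 \<or> y = 3 \<or> y = 4" "x = 0 \<or> x = 1 \<or> x = 2 \<or> x = 3"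
    using xy by linarith+
  then show "A \<in> {{0,1}, {2,3}, {2,4}, {3,4}, {0,4}, {1,3}, {0,2}, {1,4}, {0,3}, {1,2}}"
    using xy by (elim disjE) (simp_all add: A)
qed (auto simp: pair_vertices_def)

text \<open>Around a root \<open>v\<close> with neighbours \<open>a\<close>, \<open>b\<close>,
  \<open>c\<close>, the six other vertices form a hexagon that meets the neighbourhoods of
  \<open>a\<close>, \<open>b\<close>, \<open>c\<close> cyclically. Walking along it names all
  vertices.\<close>

lemma petersen_unique:
  fixes W :: "'a set" and N :: "'a \<Rightarrow> 'a set"
  assumes W: "card W = 10"
    and N: "\<And>x. N x \<subseteq> W" "\<And>x. x \<in> W \<Longrightarrow> card (N x) = 3"
    and sym: "\<And>x y. x \<in> W \<Longrightarrow> y \<in> N x \<Longrightarrow> x \<in> N y"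
    and irrefl: "\<And>x. x \<notin> N x"
    and triangle: "\<And>x y. x \<in> W \<Longrightarrow> y \<in> N x \<Longrightarrow> N x \<inter> N y = {}"
    and mu: "\<And>x y. x \<in> W \<Longrightarrow> y \<in> W \<Longrightarrow> x \<noteq> y \<Longrightarrow> y \<notin> N x \<Longrightarrow> card (N x \<inter> N y) = 1"
  obtains h :: "nat set \<Rightarrow> 'a" where "bij_betw h pair_vertices W"
    "\<And>A B. A \<in> pair_vertices \<Longrightarrow> B \<in> pair_vertices \<Longrightarrow> h B \<in> N (h A) \<longleftrightarrow> A \<inter> B = {}"
proof -
  have finW: "finite W"
    using W card.infinite by force
  have NW: "y \<in> W" if "y \<in> N x" for x y
    using N(1) that by auto
  have tri: False if "x \<in> W" "y \<in> N x" "z \<in> N x" "z \<in> N y" for x y z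
    using triangle[of x y] that by auto
  have meet: "\<exists>z. z \<in> N x \<and> z \<in> N y" if "x \<in> W" "y \<in> W" "x \<noteq> y" "y \<notin> N x" for x y
    using mu[OF that] by (metis Int_iff card_1_singletonE insertI1)
  have uniq: "z = w" if "x \<in> W" "y \<in> W" "x \<noteq> y" "z \<in> N x" "z \<in> N y" "w \<in> N x" "w \<in> N y" for x y z w
  proof -
    have "y \<notin> N x"
      using tri[of x y z] that by auto
    then show ?thesis
      using mu[of x y] that by (metis Int_iff card_1_singletonE singletonD)
  qed
  obtain v where v: "v \<in> W"
    using W by fastforce
  obtain a b c where Nv: "N v = {a, b, c}" and abc: "a \<noteq> b" "b \<noteq> c" "a \<noteq> c"
    using N(2)[OF v] by (auto simp: card_3_iff)
  then have aW: "a \<in> W" "b \<in> W" "c \<in> W"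
    using NW[of _ v] by auto
  have va: "v \<in> N a" "v \<in> N b" "v \<in> N c"
    using sym[OF v] Nv by auto
  \<comment> \<open>If \<open>x\<close> were adjacent to \<open>y\<close>, then \<open>x\<close> and
    \<open>v\<close> would both be common neighbours of \<open>y\<close> and \<open>y'\<close>. So
    \<open>x\<close> and \<open>y\<close> have a common neighbour, and it is not \<open>v\<close>,
    since \<open>v\<close>, \<open>y'\<close>, \<open>x\<close> would be a triangle.\<close>
  have step: "\<exists>z. z \<in> N x \<and> z \<in> N y \<and> z \<noteq> v"
    if x: "x \<in> N y'" "x \<noteq> v" and y: "y \<in> N v" "y' \<in> N v" "y \<noteq> y'" for x y y'
  proof -
    have W': "x \<in> W" "y \<in> W" "y' \<in> W"
      by (rule NW[OF x(1)], rule NW[OF y(1)], rule NW[OF y(2)])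
    have nv: "v \<notin> N x"
      using tri[OF v y(2) _ x(1)] sym[OF W'(1)] by blast
    have "y \<noteq> x"
      using tri[OF v y(2) _ x(1)] y(1) by blast
    moreover have "x \<notin> N y"
      using uniq[OF W'(2,3) y(3) _ x(1) sym[OF v y(1)] sym[OF v y(2)]] x(2) by blast
    ultimately obtain z where "z \<in> N y" "z \<in> N x"
      using meet[OF W'(2,1)] by blast
    then show ?thesis
      using nv by blast
  qed
  obtain a1 where a1: "a1 \<in> N a" "a1 \<noteq> v"
  proof -
    have "\<not> N a \<subseteq> {v}"
      using N(2)[OF aW(1)] card_mono[of "{v}" "N a"] by auto
    then show thesis
      using that by auto
  qed
  obtain b1 where b1: "b1 \<in> N a1" "b1 \<in> N b" "b1 \<noteq> v"
    using step[of a1 a b] a1 Nv abc by auto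
  obtain c1 where c1: "c1 \<in> N b1" "c1 \<in> N c" "c1 \<noteq> v"
    using step[of b1 b c] b1 Nv abc by auto
  obtain a2 where a2: "a2 \<in> N c1" "a2 \<in> N a" "a2 \<noteq> v"
    using step[of c1 c a] c1 Nv abc by auto
  obtain b2 where b2: "b2 \<in> N a2" "b2 \<in> N b" "b2 \<noteq> v"
    using step[of a2 a b] a2 Nv abc by auto
  obtain c2 where c2: "c2 \<in> N b2" "c2 \<in> N c" "c2 \<noteq> v"
    using step[of b2 b c] b2 Nv abc by auto
  obtain a3 where a3: "a3 \<in> N c2" "a3 \<in> N a" "a3 \<noteq> v"
    using step[of c2 c a] c2 Nv abc by auto
  have inW: "a1 \<in> W" "b1 \<in> W" "c1 \<in> W" "a2 \<in> W" "b2 \<in> W" "c2 \<in> W" "a3 \<in> W"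
    using NW a1 b1 c1 a2 b2 c2 a3 by blast+
  \<comment> \<open>An equality here would close a triangle on three consecutive vertices of the
    walk.\<close>
  have d: "a2 \<noteq> a1" "b2 \<noteq> b1" "c2 \<noteq> c1" "a3 \<noteq> a2"
    using tri[of b1 c1 a1] tri[of c1 a2 b1] tri[of a2 b2 c1] tri[of b2 c2 a2] sym inW b1 c1 a2 b2 c2 a3
    by blast+
  have nb_eq: "N y = {x, z, w}" if "y \<in> W" "x \<in> N y" "z \<in> N y" "w \<in> N y" "z \<noteq> x" "w \<noteq> x" "w \<noteq> z" for x y z w
  proof (rule HOL.sym, rule card_subset_eq)
    show "finite (N y)"
      using N(1) finW finite_subset by blast
    show "{x, z, w} \<subseteq> N y" "card {x, z, w} = card (N y)"
      using that N(2) by auto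
  qed
  have Na: "N a = {v, a1, a2}" and Nb: "N b = {v, b1, b2}" and Nc: "N c = {v, c1, c2}"
    using nb_eq aW va a1 a2 b1 b2 c1 c2 d by blast+
  \<comment> \<open>The hexagon closes because \<open>N a\<close> has only three elements.\<close>
  have "a3 = a1"
    using a3 d Na by auto
  then have c2a1: "a1 \<in> N c2"
    using a3 by simp
  define h where "h = (\<lambda>A::nat set. if A = {0,1} then v else if A = {2,3} then a else if A = {2,4} then b
    else if A = {3,4} then c else if A = {0,4} then a1 else if A = {1,3} then b1 else if A = {0,2} then c1
    else if A = {1,4} then a2 else if A = {0,3} then b2 else c2)"
  have hv: "h {0,1} = v" "h {2,3} = a" "h {2,4} = b" "h {3,4} = c" "h {0,4} = a1" "h {1,3} = b1" "h {0,2} = c1"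
    "h {1,4} = a2" "h {0,3} = b2" "h {1,2} = c2"
    by (simp_all add: h_def doubleton_eq_iff)
  have img: "h ` pair_vertices = {v, a, b, c, a1, b1, c1, a2, b2, c2}"
    unfolding pair_vertices_eq image_insert image_empty hv ..
  have "W \<subseteq> {v, a, b, c, a1, b1, c1, a2, b2, c2}"
  proof
    fix w assume w: "w \<in> W"
    show "w \<in> {v, a, b, c, a1, b1, c1, a2, b2, c2}"
    proof (cases "w = v \<or> w \<in> N v")
      case True
      then show ?thesis
        using Nv by auto
    next
      case False
      then obtain z where "z \<in> N v" "z \<in> N w"
        using meet[of v w] v w by auto
      then have "w \<in> N a \<or> w \<in> N b \<or> w \<in> N c"
        using Nv sym[OF w] by auto
      then show ?thesis
        using Na Nb Nc by auto
    qed
  qed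
  moreover have "{v, a, b, c, a1, b1, c1, a2, b2, c2} \<subseteq> W"
    using v aW inW by simp
  ultimately have img_W: "h ` pair_vertices = W"
    unfolding img by (rule subset_antisym[rotated])
  have fin: "finite pair_vertices" and "card pair_vertices = 10"
    by (simp_all add: pair_vertices_eq doubleton_eq_iff)
  then have inj: "inj_on h pair_vertices"
    using img_W W by (intro eq_card_imp_inj_on) auto
  have edges: "\<forall>A\<in>pair_vertices. \<forall>B\<in>pair_vertices. A \<inter> B = {} \<longrightarrow> h B \<in> N (h A)"
  proof -
    have 1: "a \<in> N a1" "a \<in> N a2" "b \<in> N b1" "b \<in> N b2" "c \<in> N c1" "c \<in> N c2"
      using sym aW a1 a2 b1 b2 c1 c2 by blast+
    have 2: "a1 \<in> N b1" "b1 \<in> N c1" "c1 \<in> N a2" "a2 \<in> N b2" "b2 \<in> N c2" "c2 \<in> N a1"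
      using sym inW a2 b1 b2 c1 c2 c2a1 by blast+
    show ?thesis
      unfolding pair_vertices_eq ball_simps hv
      using 1 2 c2a1 a2(1) b1(1) b2(1) c1(1) c2(1) by (simp add: Na Nb Nc Nv)
  qed
  \<comment> \<open>Disjointness was shown to imply adjacency; the converse holds because both
    relations are cubic.\<close>
  have "h B \<in> N (h A) \<longleftrightarrow> A \<inter> B = {}" if A: "A \<in> pair_vertices" and B: "B \<in> pair_vertices" for A B
  proof -
    let ?D = "{B \<in> pair_vertices. A \<inter> B = {}}"
    have filter: "{x \<in> insert y S. P x} = (if P y then insert y {x \<in> S. P x} else {x \<in> S. P x})" for y :: "nat set" and S P
      by auto
    have "\<forall>A\<in>pair_vertices. card {B \<in> pair_vertices. A \<inter> B = {}} = 3"
      unfolding pair_vertices_eq ball_simps filter by (simp add: doubleton_eq_iff)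
    then have "card ?D = 3"
      using A by simp
    then have "card (h ` ?D) = 3"
      using inj by (subst card_image) (auto intro: inj_on_subset)
    moreover have "h A \<in> W"
      using A img_W by auto
    moreover have "h ` ?D \<subseteq> N (h A)"
      using edges A by auto
    moreover have "finite (N (h A))"
      using N(1) finW finite_subset by blast
    ultimately have "h ` ?D = N (h A)"
      using N(2) by (intro card_subset_eq) auto
    then have "h B \<in> N (h A) \<longleftrightarrow> h B \<in> h ` ?D"
      by simp
    also have "\<dots> \<longleftrightarrow> B \<in> ?D"
      using inj B by (auto dest: inj_onD)
    finally show ?thesis
      using B by simp
  qed
  then show thesis
    using that[of h] inj img_W by (simp add: bij_betw_def)
qed

section \<open>The classification\<close>

lemma pair_wf_petersen_cone: "pair_wf_digraph petersen_cone"
  by unfold_locales (auto simp: petersen_cone_def cone_def petersen_graph_def)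

lemma pair_wf_van_dam_fano: "pair_wf_digraph van_dam_fano_graph"
  by unfold_locales (auto simp: van_dam_fano_graph_def)

lemma pverts_petersen: "pverts petersen_graph = pair_vertices"
  by (simp add: petersen_graph_def pair_vertices_def)

lemma parcs_petersen: "(A, B) \<in> parcs petersen_graph \<longleftrightarrow> A \<in> pair_vertices \<and> B \<in> pair_vertices \<and> A \<inter> B = {}"
  by (simp add: petersen_graph_def pair_vertices_def)

context biregular_three
begin

lemma petersen_cone_iso:
  assumes G: "pair_wf_digraph G" "pverts G = V" "\<And>x y. (x, y) \<in> parcs G \<longleftrightarrow> x \<in> V \<and> y \<in> V \<and> E x y"
    and join: "\<And>x y. x \<in> V1 \<Longrightarrow> y \<in> V2 \<Longrightarrow> E x y"
  shows "digraph_iso (with_proj G) (with_proj petersen_cone)"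
proof -
  have params: "t = 2" "card V1 = 1" "card V2 = 10" "k22 = 3" "b\<^sup>2 = 2"
    using complete_join join by blast+
  obtain x where x: "V1 = {x}"
    using params(2) by (auto simp: card_1_singleton_iff)
  have xV: "x \<in> V" "x \<notin> V2"
    using x disj V_eq by auto
  define N where "N = (\<lambda>y. nb y \<inter> V2)"
  \<comment> \<open>The apex \<open>x\<close> is a common neighbour of any two vertices of
    \<open>V2\<close>; removing it leaves none for adjacent pairs and one for nonadjacent
    pairs.\<close>
  have inter: "nb y \<inter> nb z = insert x (N y \<inter> N z)" if "y \<in> V2" "z \<in> V2" for y z
  proof -
    have "x \<in> nb y" "x \<in> nb z"
      using that join sym x xV by (auto simp: in_nb)
    then show ?thesis
      using V_eq x nb_subset[of y] by (auto simp: N_def)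
  qed
  have card_inter: "card (nb y \<inter> nb z) = Suc (card (N y \<inter> N z))" if "y \<in> V2" "z \<in> V2" for y z
    using inter[OF that] xV by (simp add: N_def)
  have "\<exists>h. bij_betw h pair_vertices V2
    \<and> (\<forall>A\<in>pair_vertices. \<forall>B\<in>pair_vertices. h B \<in> N (h A) \<longleftrightarrow> A \<inter> B = {})"
  proof (rule petersen_unique[of V2 N])
    show "card V2 = 10"
      using params by simp
    show "N y \<subseteq> V2" for y
      by (simp add: N_def)
    show "card (N y) = 3" if "y \<in> V2" for y
      using card_nb_V2(2)[OF that] params by (simp add: N_def)
    show "y \<in> N z" if "y \<in> V2" "z \<in> N y" for y z
      using that sym by (auto simp: N_def in_nb V2D)
    show "y \<notin> N y" for y
      using nb_irrefl by (simp add: N_def)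
    show "N y \<inter> N z = {}" if "y \<in> V2" "z \<in> N y" for y z
    proof -
      have "z \<in> V2" "E y z"
        using that by (auto simp: N_def in_nb)
      then have "real (card (nb y \<inter> nb z)) = 1"
        using common_adj[of y z] that params by (simp add: V2D power2_eq_square)
      then show ?thesis
        using card_inter[OF that(1) \<open>z \<in> V2\<close>] by (simp add: N_def)
    qed
    show "card (N y \<inter> N z) = 1" if "y \<in> V2" "z \<in> V2" "y \<noteq> z" "z \<notin> N y" for y z
    proof -
      have "\<not> E y z"
        using that by (auto simp: N_def in_nb V2D)
      then have "real (card (nb y \<inter> nb z)) = 2"
        using common_nonadj[of y z] that params by (simp add: V2D power2_eq_square)
      then show ?thesis
        using card_inter[OF that(1,2)] by simp
    qed
  qed blast
  then obtain h where h: "bij_betw h pair_vertices V2"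
    and hN: "\<forall>A\<in>pair_vertices. \<forall>B\<in>pair_vertices. h B \<in> N (h A) \<longleftrightarrow> A \<inter> B = {}"
    by (elim exE conjE)
  have hV2: "h A \<in> V2" if "A \<in> pair_vertices" for A
    using h that by (auto simp: bij_betw_def)
  let ?h = "case_option x h"
  show ?thesis
  proof (rule digraph_isoI[OF G(1) pair_wf_petersen_cone, of ?h])
    have "inj_on ?h (insert None (Some ` pair_vertices))"
      using h hV2 xV by (auto simp: inj_on_def bij_betw_def)
    moreover have "?h ` insert None (Some ` pair_vertices) = V"
      using h V_eq x by (auto simp: bij_betw_def image_image)
    ultimately show "bij_betw ?h (pverts petersen_cone) (pverts G)"
      by (simp add: petersen_cone_def cone_def pverts_petersen G bij_betw_def)
    fix u v assume "u \<in> pverts petersen_cone" "v \<in> pverts petersen_cone"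
    then have uv: "u = None \<or> (\<exists>A\<in>pair_vertices. u = Some A)" "v = None \<or> (\<exists>A\<in>pair_vertices. v = Some A)"
      by (auto simp: petersen_cone_def cone_def pverts_petersen)
    have E1: "E x (h A)" "E (h A) x" if "A \<in> pair_vertices" for A
      using hV2[OF that] join x sym by auto
    have E2: "E (h A) (h B) \<longleftrightarrow> A \<inter> B = {}" if "A \<in> pair_vertices" "B \<in> pair_vertices" for A B
      using hN[rule_format, OF that] hV2 that by (auto simp: N_def in_nb V2D)
    show "(?h u, ?h v) \<in> parcs G \<longleftrightarrow> (u, v) \<in> parcs petersen_cone"
      using uv xV irrefl
      by (auto simp: G petersen_cone_def cone_def parcs_petersen pverts_petersen E1 E2 V2D hV2)
  qed
qed

lemma van_dam_fano_iso:
  assumes G: "pair_wf_digraph G" "pverts G = V" "\<And>x y. (x, y) \<in> parcs G \<longleftrightarrow> x \<in> V \<and> y \<in> V \<and> E x y"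
    and xy: "x0 \<in> V1" "y0 \<in> V2" "\<not> E x0 y0"
  shows "digraph_iso (with_proj G) (with_proj van_dam_fano_graph)"
proof -
  note params = fano_parameters[OF xy]
  \<comment> \<open>The vertices of \<open>V2\<close> serve as points, and each vertex of
    \<open>V1\<close> gives the line of its non-neighbours.\<close>
  define line where "line = (\<lambda>x. V2 - nb x)"
  have nbV2: "nb y \<subseteq> V1" if "y \<in> V2" for y
    using card_nb_V2(2)[OF that] V2_coclique[OF xy] nb_split[of y] by (auto simp: card_eq_0_iff)
  have coclique: "\<not> E y z" if "y \<in> V2" "z \<in> V2" for y z
  proof -
    have "z \<notin> nb y"
      using nbV2[OF that(1)] that(2) disj by blast
    then show ?thesis
      using V2D(1)[OF that(2)] by (simp add: in_nb)
  qed
  have clique: "E x z" if "x \<in> V1" "z \<in> V1" "x \<noteq> z" for x z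
  proof -
    have "nb x \<inter> V1 = V1 - {x}"
      using that card_nb_V1(1)[OF that(1)] params nb_irrefl by (intro card_subset_eq) auto
    moreover have "z \<in> V1 - {x}"
      using that by simp
    ultimately have "z \<in> nb x \<inter> V1"
      by simp
    then show ?thesis
      by (simp add: in_nb)
  qed
  have card_line: "card (line x) = 3" if "x \<in> V1" for x
  proof -
    have "card (line x) = card V2 - card (nb x \<inter> V2)"
      unfolding line_def by (metis Int_commute card_Diff_subset_Int finite_Int finite_nb)
    then show ?thesis
      using card_nb_V1(2)[OF that] params by simp
  qed
  \<comment> \<open>Two points have four neighbours each and two in common, so exactly one of the
    seven vertices of \<open>V1\<close> is adjacent to neither.\<close>
  have avoid: "card {x \<in> V1. p \<in> line x \<and> q \<in> line x} = 1" if "p \<in> V2" "q \<in> V2" "p \<noteq> q" for p q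
  proof -
    have "\<not> E p q"
      using coclique that by blast
    then have "real (card (nb p \<inter> nb q)) = 2"
      using common_nonadj[of p q] that params by (simp add: V2D power2_eq_square)
    moreover have "card (nb p) = 4" "card (nb q) = 4"
      using card_nb_V2(1)[OF that(1)] card_nb_V2(1)[OF that(2)] nbV2 that params by (simp_all add: Int_absorb2)
    ultimately have "card (nb p \<union> nb q) = 6"
      using card_Un_Int[of "nb p" "nb q"] by simp
    moreover have "{x \<in> V1. p \<in> line x \<and> q \<in> line x} = V1 - (nb p \<union> nb q)"
      using that sym by (auto simp: line_def in_nb V1D V2D)
    ultimately show ?thesis
      using nbV2 that params by (simp add: card_Diff_subset)
  qed
  have unique: "x = x'" if "p \<noteq> q" "x \<in> V1" "x' \<in> V1" "p \<in> line x" "q \<in> line x" "p \<in> line x'" "q \<in> line x'" for p q x x'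
  proof -
    have "p \<in> V2" "q \<in> V2"
      using that by (auto simp: line_def)
    then have "card {x \<in> V1. p \<in> line x \<and> q \<in> line x} = 1"
      using avoid that by blast
    moreover have "x \<in> {x \<in> V1. p \<in> line x \<and> q \<in> line x}" "x' \<in> {x \<in> V1. p \<in> line x \<and> q \<in> line x}"
      using that by auto
    ultimately show ?thesis
      by (metis card_1_singletonE singletonD)
  qed
  have "\<exists>p. bij_betw p {..<7} V2 \<and> (\<lambda>l. p ` l) ` fano_lines = line ` V1"
  proof (rule fano_plane_unique[of V2 "line ` V1"])
    show "card V2 = 7" "finite (line ` V1)"
      using params by auto
    show "card (line ` V1) \<le> 7"
      using card_image_le[of V1 line] params by simp
    show "l \<subseteq> V2 \<and> card l = 3" if "l \<in> line ` V1" for l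
      using that card_line by (auto simp: line_def)
    show "\<exists>l\<in>line ` V1. y \<in> l \<and> z \<in> l" if yz: "y \<in> V2" "z \<in> V2" "y \<noteq> z" for y z
    proof -
      have "{x \<in> V1. y \<in> line x \<and> z \<in> line x} \<noteq> {}"
        using avoid[OF yz] by force
      then show ?thesis
        by auto
    qed
    show "l = m" if "y \<noteq> z" "l \<in> line ` V1" "m \<in> line ` V1" "y \<in> l" "z \<in> l" "y \<in> m" "z \<in> m" for y z l m
      using that unique by blast
  qed blast
  then obtain p where p: "bij_betw p {..<7} V2" and pL: "(\<lambda>l. p ` l) ` fano_lines = line ` V1"
    by blast
  have inj_line: "inj_on line V1"
  proof (rule inj_onI)
    fix x x' assume *: "x \<in> V1" "x' \<in> V1" "line x = line x'"
    then have "\<not> card (line x) \<le> Suc 0"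
      using card_line by simp
    then obtain y z where "y \<in> line x" "z \<in> line x" "y \<noteq> z"
      using card_le_Suc0_iff_eq[of "line x"] by (auto simp: line_def)
    then show "x = x'"
      using unique * by metis
  qed
  let ?B = fano_complement_blocks
  have fp: "fano_points = {..<7}"
    by (simp add: fano_points_def)
  have compl: "bij_betw (\<lambda>B. fano_points - B) ?B fano_lines"
  proof (rule bij_betw_byWitness[where f' = "\<lambda>L. fano_points - L"])
    show "\<forall>B\<in>?B. fano_points - (fano_points - B) = B" "\<forall>L\<in>fano_lines. fano_points - (fano_points - L) = L"
      "(\<lambda>B. fano_points - B) ` ?B \<subseteq> fano_lines"
      using fano_lines_subset by (auto simp: fano_complement_blocks_def fp double_diff)
    show "(\<lambda>L. fano_points - L) ` fano_lines \<subseteq> ?B"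
      by (simp add: fano_complement_blocks_def)
  qed
  have "inj_on (\<lambda>l. p ` l) fano_lines"
    using p fano_lines_subset by (auto intro!: inj_onI simp: bij_betw_def inj_on_image_eq_iff)
  then have img: "bij_betw (\<lambda>l. p ` l) fano_lines (line ` V1)"
    using pL by (simp add: bij_betw_def)
  \<comment> \<open>A block is sent to the vertex of \<open>V1\<close> whose line is the image of
    the complementary Fano line.\<close>
  define g where "g = (\<lambda>B. inv_into V1 line (p ` (fano_points - B)))"
  have g: "bij_betw g ?B V1"
    using bij_betw_trans[OF bij_betw_trans[OF compl img] bij_betw_inv_into[OF inj_on_imp_bij_betw[OF inj_line]]]
    by (simp add: g_def comp_def)
  have line_g: "line (g B) = p ` (fano_points - B)" if "B \<in> ?B" for B
  proof -
    have "p ` (fano_points - B) \<in> line ` V1"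
      using that compl by (auto simp: bij_betw_def pL[symmetric])
    then show ?thesis
      by (simp add: g_def f_inv_into_f)
  qed
  have gV1: "g B \<in> V1" if "B \<in> ?B" for B
    using g that by (auto simp: bij_betw_def)
  have pV2: "p i \<in> V2" if "i \<in> fano_points" for i
    using p that by (auto simp: bij_betw_def fp)
  have E_pg: "E (p i) (g B) \<longleftrightarrow> i \<in> B" if i: "i \<in> fano_points" and B: "B \<in> ?B" for i B
  proof -
    have "E (p i) (g B) \<longleftrightarrow> p i \<notin> line (g B)"
      using pV2[OF i] sym by (auto simp: line_def in_nb V2D)
    also have "\<dots> \<longleftrightarrow> i \<in> B"
      unfolding line_g[OF B] using p i by (subst inj_on_image_mem_iff[of p "{..<7}"]) (auto simp: bij_betw_def fp)
    finally show ?thesis .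
  qed
  have E_gg: "E (g B) (g C) \<longleftrightarrow> B \<noteq> C" if "B \<in> ?B" "C \<in> ?B" for B C
    using clique[of "g B" "g C"] irrefl that gV1 g by (auto simp: bij_betw_def inj_on_def)
  have E_pp: "\<not> E (p i) (p j)" if "i \<in> fano_points" "j \<in> fano_points" for i j
    using coclique pV2 that by blast
  let ?h = "case_sum p g"
  show ?thesis
  proof (rule digraph_isoI[OF G(1) pair_wf_van_dam_fano, of ?h])
    have inj: "inj_on p fano_points" "inj_on g ?B"
      using p g by (simp_all add: bij_betw_def fp)
    have ne: "p i \<noteq> g B" if "i \<in> fano_points" "B \<in> ?B" for i B
      using pV2[OF that(1)] gV1[OF that(2)] disj by auto
    have "inj_on ?h (Inl ` fano_points \<union> Inr ` ?B)"
      by (rule inj_onI)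
        (auto simp: inj_on_eq_iff[OF inj(1)] inj_on_eq_iff[OF inj(2)] ne ne[symmetric])
    moreover have "?h ` (Inl ` fano_points \<union> Inr ` ?B) = V"
      using p g V_eq by (simp add: bij_betw_def image_Un image_image fp Un_commute)
    ultimately show "bij_betw ?h (pverts van_dam_fano_graph) (pverts G)"
      by (simp add: van_dam_fano_graph_def G bij_betw_def)
    fix u v assume "u \<in> pverts van_dam_fano_graph" "v \<in> pverts van_dam_fano_graph"
    then have uv: "(\<exists>i\<in>fano_points. u = Inl i) \<or> (\<exists>B\<in>?B. u = Inr B)"
      "(\<exists>i\<in>fano_points. v = Inl i) \<or> (\<exists>B\<in>?B. v = Inr B)"
      by (auto simp: van_dam_fano_graph_def)
    have E_gp: "E (g B) (p i) \<longleftrightarrow> i \<in> B" if "i \<in> fano_points" "B \<in> ?B" for i B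
      using E_pg[OF that] sym by blast
    show "(?h u, ?h v) \<in> parcs G \<longleftrightarrow> (u, v) \<in> parcs van_dam_fano_graph"
      using uv by (elim disjE bexE)
        (simp_all add: G van_dam_fano_graph_def E_pg E_gp E_gg E_pp pV2 gV1 V1D V2D)
  qed
qed

end

section \<open>From digraphs and adjacency matrices to functions on vertices\<close>

lemma fin_graph_pair_graph:
  assumes "pair_graph G"
  shows "fin_graph (pverts G) (\<lambda>x y. (x, y) \<in> parcs G)"
proof -
  interpret pair_graph G by fact
  show ?thesis
    by (rule fin_graph.intro) (simp_all add: pair_finite_verts arcs_symmetric, use no_loops' in blast)
qed

lemma graph_eigenvalues_iff:
  assumes G: "pair_graph G"
  shows "l \<in> graph_eigenvalues G \<longleftrightarrow> (\<exists>f. fin_graph.eigenfun (pverts G) (\<lambda>x y. (x, y) \<in> parcs G) l f)"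
proof -
  interpret G: pair_graph G by fact
  interpret fin_graph "pverts G" "\<lambda>x y. (x, y) \<in> parcs G"
    using G by (rule fin_graph_pair_graph)
  define vs where "vs = vertex_list G"
  define n where "n = length vs"
  have "\<exists>vs. distinct vs \<and> set vs = pverts G"
    using G.pair_finite_verts finite_distinct_list by blast
  then have vs: "distinct vs" "set vs = pverts G"
    unfolding vs_def vertex_list_def by (metis (mono_tags, lifting) someI_ex)+
  have bij: "bij_betw ((!) vs) {..<n} (pverts G)"
    by (simp add: bij_betw_nth vs n_def)
  define A where "A = adjacency_matrix G"
  have A: "A = mat n n (\<lambda>(i, j). if (vs ! i, vs ! j) \<in> parcs G then 1 else 0)"
    by (simp add: A_def adjacency_matrix_def vs_def n_def Let_def)
  \<comment> \<open>Vectors and functions correspond along the enumeration \<open>vs\<close>, under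
    which the matrix product becomes \<open>adj_op\<close>.\<close>
  have key: "eigenvector A v l \<longleftrightarrow> eigenfun l f"
    if v: "v \<in> carrier_vec n" and f: "\<And>i. i < n \<Longrightarrow> f (vs ! i) = v $ i" for v f
  proof -
    have Av: "(A *\<^sub>v v) $ i = adj_op f (vs ! i)" if i: "i < n" for i
    proof -
      have "(A *\<^sub>v v) $ i = (\<Sum>j<n. if (vs ! i, vs ! j) \<in> parcs G then f (vs ! j) else 0)"
        using i v by (auto simp: A scalar_prod_def f atLeast0LessThan intro!: sum.cong)
      also have "\<dots> = adj_op f (vs ! i)"
        unfolding adj_op_if by (rule sum.reindex_bij_betw[OF bij])
      finally show ?thesis .
    qed
    have "pverts G = (!) vs ` {..<n}"
      using bij by (simp add: bij_betw_def)
    then have all: "(\<forall>x\<in>pverts G. P x) \<longleftrightarrow> (\<forall>i<n. P (vs ! i))" for P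
      by auto
    have "v \<noteq> 0\<^sub>v n \<longleftrightarrow> \<not> (\<forall>x\<in>pverts G. f x = 0)"
      using v by (auto simp: all f vec_eq_iff)
    moreover have "A *\<^sub>v v = l \<cdot>\<^sub>v v \<longleftrightarrow> (\<forall>x\<in>pverts G. adj_op f x = l * f x)"
      unfolding all using v by (auto simp: f vec_eq_iff Av) (simp_all add: A Av[symmetric])
    ultimately show ?thesis
      using v by (auto simp: eigenvector_def eigenfun_def A)
  qed
  have "(\<exists>v. eigenvector A v l) \<longleftrightarrow> (\<exists>f. eigenfun l f)"
  proof
    assume "\<exists>v. eigenvector A v l"
    then obtain v where v: "eigenvector A v l"
      by blast
    then have "v \<in> carrier_vec n"
      by (simp add: eigenvector_def A)
    moreover have "v $ inv_into {..<n} ((!) vs) (vs ! i) = v $ i" if "i < n" for i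
      using that bij by (simp add: bij_betw_def inv_into_f_f)
    ultimately show "\<exists>f. eigenfun l f"
      using key[of v "\<lambda>x. v $ inv_into {..<n} ((!) vs) x"] v by blast
  next
    assume "\<exists>f. eigenfun l f"
    then obtain f where "eigenfun l f"
      by blast
    then show "\<exists>v. eigenvector A v l"
      using key[of "vec n (\<lambda>i. f (vs ! i))" f] by auto
  qed
  then show ?thesis
    by (simp add: graph_eigenvalues_def spectrum_def eigenvalue_def A_def)
qed

text \<open>Connectedness is defined by reachability in the symmetric closure, which has the same
  arcs here; induction along a path keeps it inside \<open>Z\<close>.\<close>

lemma connected_closed_set:
  assumes G: "pair_graph G" and conn: "Digraph_Component.connected (with_proj G)"
    and Z: "Z \<subseteq> pverts G" "Z \<noteq> {}" "\<And>x y. x \<in> Z \<Longrightarrow> (x, y) \<in> parcs G \<Longrightarrow> y \<in> Z"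
  shows "Z = pverts G"
proof -
  interpret G: pair_graph G by fact
  let ?S = "with_proj (mk_symmetric (with_proj G))"
  have arcs: "parcs (mk_symmetric (with_proj G)) = parcs G"
    using G.arcs_symmetric by (auto simp: parcs_mk_symmetric)
  obtain z where z: "z \<in> Z"
    using Z by auto
  have "v \<in> Z" if "v \<in> pverts G" for v
  proof -
    have "z \<rightarrow>\<^sup>*\<^bsub>?S\<^esub> v"
      using conn that z Z by (auto simp: connected_def strongly_connected_def)
    then have "(z, v) \<in> rtrancl_on (pverts G) (parcs G)"
      by (simp add: reachable_def arcs)
    then show ?thesis
      by (induction rule: rtrancl_on_induct) (use z Z in auto)
  qed
  then show ?thesis
    using Z by auto
qed

theorem proposition4p11:
  fixes \<Gamma> :: "'a pair_pre_digraph" and \<theta>\<^sub>0 t :: real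
  assumes "\<theta>\<^sub>0 > 1" and "1 > - t"
    and "\<Gamma> \<in> three_eigenvalue_graphs \<theta>\<^sub>0 1 (- t)"
    and "biregular_graph \<Gamma>"
  shows "t = 2 \<and>
    (digraph_iso (with_proj \<Gamma>) (with_proj petersen_cone) \<or>
     digraph_iso (with_proj \<Gamma>) (with_proj van_dam_fano_graph))"
proof -
  have pg: "pair_graph \<Gamma>" and conn: "Digraph_Component.connected (with_proj \<Gamma>)"
    and spec: "graph_eigenvalues \<Gamma> = {\<theta>\<^sub>0, 1, - t}"
    using assms(3) by (simp_all add: three_eigenvalue_graphs_def)
  interpret G: pair_graph \<Gamma> by fact
  interpret fin_graph "pverts \<Gamma>" "\<lambda>x y. (x, y) \<in> parcs \<Gamma>"
    using pg by (rule fin_graph_pair_graph)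
  interpret three_eigenvalues "pverts \<Gamma>" "\<lambda>x y. (x, y) \<in> parcs \<Gamma>" \<theta>\<^sub>0 t
  proof (rule three_eigenvalues.intro[OF fin_graph_axioms three_eigenvalues_axioms.intro])
    show "Z = pverts \<Gamma>" if Z: "Z \<subseteq> pverts \<Gamma>" "Z \<noteq> {}" "\<And>x. x \<in> Z \<Longrightarrow> nb x \<subseteq> Z" for Z
    proof (rule connected_closed_set[OF pg conn Z(1,2)])
      fix x y assume "x \<in> Z" "(x, y) \<in> parcs \<Gamma>"
      then show "y \<in> Z"
        using Z(3)[of x] G.in_arcsD2 by (auto simp: nb_def)
    qed
    show "(\<exists>f. eigenfun l f) \<longleftrightarrow> l \<in> {\<theta>\<^sub>0, 1, - t}" for l
      using graph_eigenvalues_iff[OF pg, of l] unfolding spec by simp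
  qed (rule assms)+
  obtain al where al_pos: "\<And>x. x \<in> pverts \<Gamma> \<Longrightarrow> al x > 0"
    and al: "\<And>x. x \<in> pverts \<Gamma> \<Longrightarrow> (\<Sum>y\<in>nb x. al y) = \<theta>\<^sub>0 * al x"
    "\<And>x y. x \<in> pverts \<Gamma> \<Longrightarrow> y \<in> pverts \<Gamma> \<Longrightarrow> real (card (nb x \<inter> nb y))
       = al x * al y - (if (x, y) \<in> parcs \<Gamma> then t - 1 else 0) + (if x = y then t else 0)"
    "\<And>h. ip h (adj_op h) \<le> ip h h + (ip al h)\<^sup>2 / (\<theta>\<^sub>0 + t)"
    by (rule rank_one) blast
  define dg where "dg = out_degree (with_proj \<Gamma>)"
  have deg: "dg x = card (nb x)" if "x \<in> pverts \<Gamma>" for x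
  proof -
    have "out_arcs (with_proj \<Gamma>) x = Pair x ` nb x"
      using G.in_arcsD2 by (auto simp: out_arcs_def nb_def)
    then show ?thesis
      by (simp add: dg_def out_degree_def card_image inj_on_def)
  qed
  \<comment> \<open>The valency determines the Perron entry, monotonically, so two valencies give
    exactly the two values \<open>a\<close> and \<open>b\<close>.\<close>
  have al_deg: "al x = sqrt (real (dg x) - t)" if "x \<in> pverts \<Gamma>" for x
  proof -
    have "real (dg x) - t = (al x)\<^sup>2"
      using al(2)[of x x] that irrefl by (simp add: deg power2_eq_square)
    then show ?thesis
      using al_pos[OF that] by simp
  qed
  obtain d1 d2 where d: "dg ` pverts \<Gamma> = {d1, d2}" "d1 < d2"
  proof -
    obtain d1 d2 where "dg ` pverts \<Gamma> = {d1, d2}" "d1 \<noteq> d2"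
      using assms(4) by (auto simp: biregular_graph_def valencies_def dg_def card_2_iff)
    then show thesis
      using that[of d1 d2] that[of d2 d1] by (metis insert_commute linorder_neqE_nat)
  qed
  define a b where "a = sqrt (real d2 - t)" and "b = sqrt (real d1 - t)"
  have "al ` pverts \<Gamma> = (\<lambda>k. sqrt (real k - t)) ` dg ` pverts \<Gamma>"
    unfolding image_image using al_deg by (intro image_cong) auto
  then have img: "al ` pverts \<Gamma> = {a, b}"
    by (auto simp: d a_def b_def)
  have "b \<in> al ` pverts \<Gamma>"
    using img by simp
  then have "0 < b"
    using al_pos by auto
  moreover have "b < a"
    using d by (simp add: a_def b_def)
  ultimately interpret biregular_three "pverts \<Gamma>" "\<lambda>x y. (x, y) \<in> parcs \<Gamma>" al \<theta>\<^sub>0 t a b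
    using al img assms by unfold_locales auto
  have arcs: "(x, y) \<in> parcs \<Gamma> \<longleftrightarrow> x \<in> pverts \<Gamma> \<and> y \<in> pverts \<Gamma> \<and> (x, y) \<in> parcs \<Gamma>" for x y
    using G.in_arcsD1 G.in_arcsD2 by auto
  show ?thesis
  proof (cases "\<forall>x\<in>V1. \<forall>y\<in>V2. (x, y) \<in> parcs \<Gamma>")
    case True
    then show ?thesis
      using complete_join(1) petersen_cone_iso[OF G.pair_wf_digraph_axioms refl arcs] by blast
  next
    case False
    then show ?thesis
      using fano_parameters(1) van_dam_fano_iso[OF G.pair_wf_digraph_axioms refl arcs] by blast
  qed
qed

end
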